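(* There exist universal constants $c_\gamma>0$ and $C>0$ such that the following holds. Consider any episodic MDP with finite state space of size $S$, finite action space of size $A$, horizon $H$, unknown transition kernels and deterministic rewards in $[0,1]$, any risk parameter $\beta\neq0$, any number of episodes $K$ and any $\delta\in(0,1]$, and let $T=KH$. If the algorithm RSVI (described in the context) is run for $K$ episodes with bonus constant $c_\gamma$, then with probability at least $1-\delta$, $$\mathrm{Regret}(K)\le C\,\lambda(|\beta|H^2)\sqrt{H^3S^2AT\log^2(2SAT/\delta)},\qquad\text{where }\lambda(u)=\frac{e^{3u}-1}{u}.$$
   Context: Setting: episodic MDP with finite state space $\mathcal{S}$ ($|\mathcal{S}|=S$), finite action space $\mathcal{A}$ ($|\mathcal{A}|=A$), horizon $H$, transition kernels $P_h(\cdot\mid s,a)$ unknown to the agent, deterministic rewards $r_h:\mathcal{S}\times\mathcal{A}\to[0,1]$. In each episode $k$ the environment picks an arbitrary initial state $s_1^k$; at step $h$ the agent observes $s_h$, takes $a_h$, receives $r_h(s_h,a_h)$, and $s_{h+1}\sim P_h(\cdot\mid s_h,a_h)$; the episode ends after step $H$. For a deterministic policy $\pi=\{\pi_h:\mathcal{S}\to\mathcal{A}\}$ and $\beta\ne0$, $V_h^\pi(s)=\frac1\beta\log\mathbb{E}[\exp(\beta\sum_{h'=h}^H r_{h'}(s_{h'},\pi_{h'}(s_{h'})))\mid s_h=s]$, $V_h^*=\sup_\pi V_h^\pi$, and $\mathrm{Regret}(K)=\sum_{k=1}^K[V_1^*(s_1^k)-V_1^{\pi^k}(s_1^k)]$,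 where $\pi^k$ is the policy the algorithm executes in episode $k$. Algorithm RSVI (inputs $K$, $\delta$, $\beta$; constant $c_\gamma$): initialize counts $N_h(s,a)=0$, empty datasets $\mathcal{D}_h$, $Q_h(s,a)=H-h+1$ for $h\in[H]$, and $Q_{H+1}\equiv0$. In each episode $k=1,\dots,K$: set $V_{H+1}\equiv0$; for $h=H,H-1,\dots,1$: for every $(s,a)$ with $N_h(s,a)\ge1$ let $w_h(s,a)$ be the average of $\exp(\beta[r_h(s,a)+V_{h+1}(s')])$ over all stored triples $(s,a,s')\in\mathcal{D}_h$ with first two entries $(s,a)$ (equivalently the least-squares solution over indicator features), let $b_h(s,a)=c_\gamma|e^{\beta H}-1|\sqrt{S\log(2SAT/\delta)/N_h(s,a)}$, and set $Q_h(s,a)=\frac1\beta\log[\min\{e^{\beta(H-h+1)},w_h(s,a)+b_h(s,a)\}]$ if $\beta>0$, and $Q_h(s,a)=\frac1\beta\log[\max\{e^{\beta(H-h+1)},w_h(s,a)-b_h(s,a)\}]$ if $\beta<0$ (pairs with $N_h(s,a)=0$ keep their previous value); set $V_h(s)=\max_{a'}Q_h(s,a')$. Then for $h=1,\dots,H$: take $a_h=\arg\max_a Q_h(s_h,a)$, observe $r_h(s_h,a_h)$ and $s_{h+1}$, increment $N_h(s_h,a_h)$ and insert $(s_h,a_h,s_{h+1})$ into $\mathcal{D}_h$. *)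

theory Defs
  imports "HOL-Probability.Probability_Mass_Function"
begin

text \<open>States are 0..S-1, actions 0..A-1, steps 1..H. A transition triple is (s, a, s').
  A history is the list of completed episodes; each episode is the list of its H
  transition triples, position i corresponding to step h = i+1.\<close>

type_synonym triple = "nat \<times> nat \<times> nat"
type_synonym history = "triple list list"

definition data_h :: "history \<Rightarrow> nat \<Rightarrow> triple list" where
  "data_h hist h = map (\<lambda>ep. ep ! (h - 1)) hist"

definition matches :: "history \<Rightarrow> nat \<Rightarrow> nat \<Rightarrow> nat \<Rightarrow> triple list" where
  "matches hist h s a = filter (\<lambda>(x, y, _). x = s \<and> y = a) (data_h hist h)"

definition count_N :: "history \<Rightarrow> nat \<Rightarrow> nat \<Rightarrow> nat \<Rightarrow> nat" where
  "count_N hist h s a = length (matches hist h s a)"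

definition rsvi_Qstep ::
  "nat \<Rightarrow> nat \<Rightarrow> nat \<Rightarrow> real \<Rightarrow> real \<Rightarrow> real \<Rightarrow> nat \<Rightarrow> (nat \<Rightarrow> nat \<Rightarrow> nat \<Rightarrow> real)
   \<Rightarrow> history \<Rightarrow> nat \<Rightarrow> (nat \<Rightarrow> real) \<Rightarrow> nat \<Rightarrow> nat \<Rightarrow> real" where
  "rsvi_Qstep H S A \<beta> c\<gamma> \<delta> T r hist h Vnext s a =
     (let n = count_N hist h s a in
      if n = 0 then real H - real h + 1
      else
        let w = (\<Sum>(x, y, s') \<leftarrow> matches hist h s a. exp (\<beta> * (r h s a + Vnext s'))) / real n;
            b = c\<gamma> * \<bar>exp (\<beta> * real H) - 1\<bar>
                  * sqrt (real S * ln (2 * real S * real A * real T / \<delta>) / real n)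
        in if \<beta> > 0 then (1 / \<beta>) * ln (min (exp (\<beta> * (real H - real h + 1))) (w + b))
           else (1 / \<beta>) * ln (max (exp (\<beta> * (real H - real h + 1))) (w - b)))"

text \<open>rsvi_V ... m is V_{H+1-m}: V_{H+1} = 0 and V_h(s) = max_a Q_h(s,a).\<close>
fun rsvi_V ::
  "nat \<Rightarrow> nat \<Rightarrow> nat \<Rightarrow> real \<Rightarrow> real \<Rightarrow> real \<Rightarrow> nat \<Rightarrow> (nat \<Rightarrow> nat \<Rightarrow> nat \<Rightarrow> real)
   \<Rightarrow> history \<Rightarrow> nat \<Rightarrow> nat \<Rightarrow> real" where
  "rsvi_V H S A \<beta> c\<gamma> \<delta> T r hist 0 s = 0"
| "rsvi_V H S A \<beta> c\<gamma> \<delta> T r hist (Suc m) s =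
     Max ((\<lambda>a. rsvi_Qstep H S A \<beta> c\<gamma> \<delta> T r hist (H - m) (rsvi_V H S A \<beta> c\<gamma> \<delta> T r hist m) s a)
          ` {..<A})"

definition rsvi_Q ::
  "nat \<Rightarrow> nat \<Rightarrow> nat \<Rightarrow> real \<Rightarrow> real \<Rightarrow> real \<Rightarrow> nat \<Rightarrow> (nat \<Rightarrow> nat \<Rightarrow> nat \<Rightarrow> real)
   \<Rightarrow> history \<Rightarrow> nat \<Rightarrow> nat \<Rightarrow> nat \<Rightarrow> real" where
  "rsvi_Q H S A \<beta> c\<gamma> \<delta> T r hist h s a =
     rsvi_Qstep H S A \<beta> c\<gamma> \<delta> T r hist h (rsvi_V H S A \<beta> c\<gamma> \<delta> T r hist (H - h)) s a"

text \<open>Greedy policy; sel is the (arbitrary) argmax rule over actions.\<close>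
definition rsvi_policy ::
  "nat \<Rightarrow> nat \<Rightarrow> nat \<Rightarrow> real \<Rightarrow> real \<Rightarrow> real \<Rightarrow> nat \<Rightarrow> (nat \<Rightarrow> nat \<Rightarrow> nat \<Rightarrow> real)
   \<Rightarrow> ((nat \<Rightarrow> real) \<Rightarrow> nat) \<Rightarrow> history \<Rightarrow> nat \<Rightarrow> nat \<Rightarrow> nat" where
  "rsvi_policy H S A \<beta> c\<gamma> \<delta> T r sel hist h s =
     sel (\<lambda>a. rsvi_Q H S A \<beta> c\<gamma> \<delta> T r hist h s a)"

fun rollout :: "(nat \<Rightarrow> nat \<Rightarrow> nat \<Rightarrow> nat pmf) \<Rightarrow> (nat \<Rightarrow> nat \<Rightarrow> nat) \<Rightarrow> nat \<Rightarrow> nat \<Rightarrow> nat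
    \<Rightarrow> triple list pmf" where
  "rollout P \<pi> h 0 s = return_pmf []"
| "rollout P \<pi> h (Suc n) s =
     bind_pmf (P h s (\<pi> h s)) (\<lambda>s'.
     bind_pmf (rollout P \<pi> (Suc h) n s') (\<lambda>rest.
     return_pmf ((s, \<pi> h s, s') # rest)))"

definition traj_return :: "(nat \<Rightarrow> nat \<Rightarrow> nat \<Rightarrow> real) \<Rightarrow> nat \<Rightarrow> triple list \<Rightarrow> real" where
  "traj_return r h tr = (\<Sum>i<length tr. r (h + i) (fst (tr ! i)) (fst (snd (tr ! i))))"

definition value1 :: "nat \<Rightarrow> real \<Rightarrow> (nat \<Rightarrow> nat \<Rightarrow> nat \<Rightarrow> nat pmf) \<Rightarrow> (nat \<Rightarrow> nat \<Rightarrow> nat \<Rightarrow> real)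
    \<Rightarrow> (nat \<Rightarrow> nat \<Rightarrow> nat) \<Rightarrow> nat \<Rightarrow> real" where
  "value1 H \<beta> P r \<pi> s =
     (1 / \<beta>) * ln (measure_pmf.expectation (rollout P \<pi> 1 H s) (\<lambda>tr. exp (\<beta> * traj_return r 1 tr)))"

definition value1_star :: "nat \<Rightarrow> nat \<Rightarrow> real \<Rightarrow> (nat \<Rightarrow> nat \<Rightarrow> nat \<Rightarrow> nat pmf)
    \<Rightarrow> (nat \<Rightarrow> nat \<Rightarrow> nat \<Rightarrow> real) \<Rightarrow> nat \<Rightarrow> real" where
  "value1_star H A \<beta> P r s = (SUP \<pi>\<in>{\<pi>. \<forall>h s. \<pi> h s < A}. value1 H \<beta> P r \<pi> s)"

text \<open>Distribution of the history after k episodes of RSVI (run with K episodes in total, T = K*H).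
  init is the environment's (possibly history-dependent) choice of initial state.\<close>
fun rsvi_run ::
  "nat \<Rightarrow> nat \<Rightarrow> nat \<Rightarrow> real \<Rightarrow> real \<Rightarrow> real \<Rightarrow> nat \<Rightarrow> (nat \<Rightarrow> nat \<Rightarrow> nat \<Rightarrow> real)
   \<Rightarrow> ((nat \<Rightarrow> real) \<Rightarrow> nat) \<Rightarrow> (nat \<Rightarrow> nat \<Rightarrow> nat \<Rightarrow> nat pmf) \<Rightarrow> (history \<Rightarrow> nat)
   \<Rightarrow> nat \<Rightarrow> history pmf" where
  "rsvi_run H S A \<beta> c\<gamma> \<delta> T r sel P init 0 = return_pmf []"
| "rsvi_run H S A \<beta> c\<gamma> \<delta> T r sel P init (Suc k) =
     bind_pmf (rsvi_run H S A \<beta> c\<gamma> \<delta> T r sel P init k) (\<lambda>hist.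
     bind_pmf (rollout P (rsvi_policy H S A \<beta> c\<gamma> \<delta> T r sel hist) 1 H (init hist)) (\<lambda>ep.
     return_pmf (hist @ [ep])))"

definition rsvi_regret ::
  "nat \<Rightarrow> nat \<Rightarrow> nat \<Rightarrow> real \<Rightarrow> real \<Rightarrow> real \<Rightarrow> nat \<Rightarrow> (nat \<Rightarrow> nat \<Rightarrow> nat \<Rightarrow> real)
   \<Rightarrow> ((nat \<Rightarrow> real) \<Rightarrow> nat) \<Rightarrow> (nat \<Rightarrow> nat \<Rightarrow> nat \<Rightarrow> nat pmf) \<Rightarrow> (history \<Rightarrow> nat)
   \<Rightarrow> nat \<Rightarrow> history \<Rightarrow> real" where
  "rsvi_regret H S A \<beta> c\<gamma> \<delta> T r sel P init K hist =
     (\<Sum>k<K. value1_star H A \<beta> P r (init (take k hist))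
            - value1 H \<beta> P r (rsvi_policy H S A \<beta> c\<gamma> \<delta> T r sel (take k hist)) (init (take k hist)))"

definition lam :: "real \<Rightarrow> real" where
  "lam u = (exp (3 * u) - 1) / u"

end

(*
  Everything is done on the scale exp (\<beta> * value), on which the Bellman equation is linear:
  the exponential value W of a policy satisfies W h s = exp (\<beta> * r h s a) * E (W (h + 1)).

  Hoeffding's lemma gives exponential supermartingales for the deviations of the empirical
  transition frequencies of every set B of states.  A union bound over the 2^S sets (this is where
  the factor S under the square root of the bonus goes), over steps, state-action pairs, counts and
  episodes makes the empirical means of all functions with the range of exp (\<beta> * V) accurate up
  to the bonus at once, so the dependence of V on the data does no harm.  On that event the
  estimates are optimistic, and their excess over the value of the greedy policy is at most the
  sum of the bonuses expected along its own trajectory.  A second supermartingale (over episodes)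
  replaces expected by realized bonuses, and these are summed by the potential
  sum of sqrt N over state-action pairs.
*)
theory Submission
  imports Defs "HOL-Probability.Hoeffding"
begin

section \<open>Finitely supported distributions and elementary estimates\<close>

lemma expectation_bind_pmf_finite:
  fixes f :: "'b \<Rightarrow> real"
  assumes "finite (set_pmf p)" "\<And>x. x \<in> set_pmf p \<Longrightarrow> finite (set_pmf (q x))"
  shows "measure_pmf.expectation (bind_pmf p q) f
       = measure_pmf.expectation p (\<lambda>x. measure_pmf.expectation (q x) f)"
  using pmf_expectation_bind[of "set_pmf p" q p f]
    integral_measure_pmf[of "set_pmf p" p "\<lambda>x. measure_pmf.expectation (q x) f"] assms
  by simp

lemma expectation_pmf_mono:
  fixes f g :: "'a \<Rightarrow> real"
  assumes "finite (set_pmf p)" "\<And>x. x \<in> set_pmf p \<Longrightarrow> f x \<le> g x"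
  shows "measure_pmf.expectation p f \<le> measure_pmf.expectation p g"
  using assms by (intro integral_mono_AE) (auto simp: integrable_measure_pmf_finite AE_measure_pmf_iff)

lemma expectation_pmf_le:
  fixes f :: "'a \<Rightarrow> real"
  assumes "finite (set_pmf p)" "\<And>x. x \<in> set_pmf p \<Longrightarrow> f x \<le> c"
  shows "measure_pmf.expectation p f \<le> c"
  using expectation_pmf_mono[OF assms(1), of f "\<lambda>_. c"] assms(2) by simp

lemma expectation_pmf_ge:
  fixes f :: "'a \<Rightarrow> real"
  assumes "finite (set_pmf p)" "\<And>x. x \<in> set_pmf p \<Longrightarrow> c \<le> f x"
  shows "c \<le> measure_pmf.expectation p f"
  using expectation_pmf_mono[OF assms(1), of "\<lambda>_. c" f] assms(2) by simp

lemma expectation_pmf_cong: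
  fixes f :: "'a \<Rightarrow> real"
  assumes "\<And>x. x \<in> set_pmf p \<Longrightarrow> f x = g x"
  shows "measure_pmf.expectation p f = measure_pmf.expectation p g"
  using assms by (intro integral_cong_AE) (auto simp: AE_measure_pmf_iff)

text \<open>Hoeffding's lemma for the nonnegative integral carries over to expectations because
  every function is integrable on a finite support.\<close>

lemma Hoeffdings_lemma_pmf:
  fixes f :: "'a \<Rightarrow> real"
  assumes fin: "finite (set_pmf p)" and f: "\<And>x. x \<in> set_pmf p \<Longrightarrow> f x \<in> {a..b}" and "l > 0"
  shows "measure_pmf.expectation p (\<lambda>x. exp (l * (f x - measure_pmf.expectation p f)))
           \<le> exp (l\<^sup>2 * (b - a)\<^sup>2 / 8)"
proof -
  interpret interval_bounded_random_variable "measure_pmf p" f a b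
    using f by unfold_locales (simp_all add: AE_measure_pmf_iff)
  have "ennreal (measure_pmf.expectation p (\<lambda>x. exp (l * (f x - measure_pmf.expectation p f))))
      = (\<integral>\<^sup>+x. exp (l * (f x - measure_pmf.expectation p f)) \<partial>p)"
    by (intro nn_integral_eq_integral[symmetric]) (auto simp: integrable_measure_pmf_finite fin)
  also have "\<dots> \<le> ennreal (exp (l\<^sup>2 * (b - a)\<^sup>2 / 8))"
    using Hoeffdings_lemma_nn_integral[OF \<open>l > 0\<close>] by simp
  finally show ?thesis by simp
qed

text \<open>Markov's inequality. The lower bound \<open>c \<le> F x\<close> is asked on the support
  only, so that almost sure facts, such as the length of a history, may enter it.\<close>

lemma pmf_exponential_Markov:
  fixes F :: "'a \<Rightarrow> real"
  assumes fin: "finite (set_pmf p)" and "\<And>x. F x \<ge> 0" and "measure_pmf.expectation p F \<le> 1"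
    and "c > 0" and E: "\<And>x. x \<in> set_pmf p \<Longrightarrow> x \<in> E \<Longrightarrow> c \<le> F x"
  shows "measure_pmf.prob p E \<le> 1 / c"
proof -
  have "measure_pmf.prob p E \<le> measure_pmf.prob p {x. F x \<ge> c}"
    using E by (intro measure_pmf.finite_measure_mono_AE) (auto simp: AE_measure_pmf_iff)
  also have "\<dots> \<le> measure_pmf.expectation p F / c"
    using integral_Markov_inequality_measure[of "measure_pmf p" F UNIV c] assms
    by (simp add: integrable_measure_pmf_finite)
  also have "\<dots> \<le> 1 / c" using assms by (simp add: divide_right_mono)
  finally show ?thesis .
qed

text \<open>Shifting \<open>f\<close> by a constant is free, so only the positive part of \<open>d\<close> matters, and it
  is collected by the single set \<open>B = {x. d x > 0}\<close>.\<close>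
lemma deviation_of_bounded_function:
  fixes d f :: "'a \<Rightarrow> real"
  assumes "finite X" and "l \<le> u" and "sum d X = 0" and B: "\<And>B. B \<subseteq> X \<Longrightarrow> sum d B \<le> e"
    and f: "\<And>x. x \<in> X \<Longrightarrow> f x \<in> {l..u}"
  shows "\<bar>\<Sum>x\<in>X. d x * f x\<bar> \<le> (u - l) * e"
proof -
  have *: "(\<Sum>x\<in>X. d x * g x) \<le> (u - l) * e"
    if "\<And>x. x \<in> X \<Longrightarrow> 0 \<le> g x" "\<And>x. x \<in> X \<Longrightarrow> g x \<le> u - l" for g
  proof -
    let ?B = "{x\<in>X. d x > 0}"
    have "(\<Sum>x\<in>X. d x * g x) \<le> (\<Sum>x\<in>X. if d x > 0 then d x * (u - l) else 0)"
      using that by (intro sum_mono) (auto intro: mult_left_mono simp: mult_nonpos_nonneg)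
    also have "\<dots> = (u - l) * sum d ?B"
      using \<open>finite X\<close> by (auto simp: sum.inter_filter sum_distrib_left intro!: sum.cong)
    also have "\<dots> \<le> (u - l) * e" using B[of ?B] \<open>l \<le> u\<close> by (intro mult_left_mono) auto
    finally show ?thesis .
  qed
  \<comment> \<open>As \<open>d\<close> sums to zero, the shift \<open>f - l\<close> leaves the sum
    unchanged and the reflection \<open>u - f\<close> negates it; this gives both sides of the
    absolute value.\<close>
  have 1: "(\<Sum>x\<in>X. d x * (f x - l)) \<le> (u - l) * e" using f by (intro *) auto
  have 2: "(\<Sum>x\<in>X. d x * (u - f x)) \<le> (u - l) * e" using f by (intro *) auto
  have "(\<Sum>x\<in>X. d x * (f x - l)) = (\<Sum>x\<in>X. d x * f x)"
    using sum_distrib_right[of d X l] \<open>sum d X = 0\<close>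
    by (simp add: right_diff_distrib sum_subtractf)
  moreover have "(\<Sum>x\<in>X. d x * (u - f x)) = - (\<Sum>x\<in>X. d x * f x)"
    using sum_distrib_right[of d X u] \<open>sum d X = 0\<close>
    by (simp add: right_diff_distrib sum_subtractf)
  ultimately show ?thesis using 1 2 by linarith
qed

lemma sum_list_map_eq_sum_count_real:
  fixes f :: "'a \<Rightarrow> real"
  assumes "finite X" "set xs \<subseteq> X"
  shows "sum_list (map f xs) = (\<Sum>x\<in>X. count_list xs x * f x)"
  using assms(2)
proof (induction xs)
  case (Cons y xs)
  have "(\<Sum>x\<in>X. real (count_list (y # xs) x) * f x)
      = (\<Sum>x\<in>X. (if x = y then f y else 0) + real (count_list xs x) * f x)"
    by (intro sum.cong) (auto simp: algebra_simps)
  also have "\<dots> = f y + (\<Sum>x\<in>X. real (count_list xs x) * f x)"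
    using Cons \<open>finite X\<close> by (simp add: sum.distrib)
  finally show ?case using Cons by simp
qed auto

lemma expectation_eq_sum_pmf:
  fixes f :: "'a \<Rightarrow> real"
  assumes "finite X" "set_pmf p \<subseteq> X"
  shows "measure_pmf.expectation p f = (\<Sum>x\<in>X. pmf p x * f x)"
  using assms by (subst integral_measure_pmf[of X]) auto

lemma sum_update_one:
  fixes f g :: "'a \<Rightarrow> real"
  assumes "finite X" "x \<in> X" "\<And>y. y \<in> X \<Longrightarrow> y \<noteq> x \<Longrightarrow> g y = f y"
  shows "sum g X = sum f X + (g x - f x)"
proof -
  have "sum g (X - {x}) = sum f (X - {x})" using assms by (intro sum.cong) auto
  then show ?thesis using assms sum.remove[of X x f] sum.remove[of X x g] by simp
qed

text \<open>Makes bonuses of order \<open>1 / sqrt n\<close> telescope. The difference of the roots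
  is the reciprocal of their sum, and the sum is at most \<open>3 * sqrt n\<close> because
  \<open>n + 1 \<le> 4 * n\<close>.\<close>

lemma inverse_sqrt_le_diff:
  assumes "n \<ge> (1::nat)"
  shows "1 / sqrt n \<le> 3 * (sqrt (n + 1) - sqrt n)"
proof -
  have n: "0 < sqrt n" using assms by simp
  have "sqrt (n + 1) \<le> sqrt (4 * n)" using assms by (intro real_sqrt_le_mono) simp
  then have "sqrt (n + 1) + sqrt n \<le> 3 * sqrt n" by (simp add: real_sqrt_mult)
  then have "3 / (3 * sqrt n) \<le> 3 / (sqrt (n + 1) + sqrt n)"
    using n by (intro divide_left_mono mult_pos_pos add_nonneg_pos) auto
  also have "\<dots> = 3 * (sqrt (n + 1) - sqrt n)"
  proof -
    have "(sqrt (n + 1) - sqrt n) * (sqrt (n + 1) + sqrt n) = 1"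
      by (simp add: algebra_simps)
    moreover have "sqrt (n + 1) + sqrt n > 0" using n by (intro add_nonneg_pos) auto
    ultimately have "3 * (sqrt (n + 1) - sqrt n) * (sqrt (n + 1) + sqrt n) = 3"
      by (simp only: mult.assoc)
    then show ?thesis using \<open>sqrt (n + 1) + sqrt n > 0\<close> by (intro divide_eq_imp) auto
  qed
  finally show ?thesis by simp
qed

text \<open>Leads to the numerator of \<open>lam\<close>, with
  \<open>y = exp (\<bar>\<beta>\<bar> * H)\<close> and \<open>n = H\<close>. Bernoulli's inequality
  moves the factor \<open>n\<close> into the exponent, and the remaining factor \<open>y\<close>
  fits in as \<open>n + 1 \<le> 3 * n\<close>.\<close>

lemma exp_factor_le:
  fixes y :: real
  assumes "1 \<le> y" "1 \<le> (n::nat)"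
  shows "n * (y * (y - 1)) \<le> y ^ (3 * n) - 1"
proof -
  have "1 + n * (y - 1) \<le> (1 + (y - 1)) ^ n" using assms by (intro Bernoulli_inequality) auto
  then have "y * (n * (y - 1)) \<le> y * (y ^ n - 1)" using assms by (intro mult_left_mono) auto
  also have "\<dots> \<le> y ^ Suc n - 1" using assms by (simp add: algebra_simps)
  also have "\<dots> \<le> y ^ (3 * n) - 1" using assms by (intro diff_right_mono power_increasing) auto
  finally show ?thesis by (simp add: mult_ac)
qed

section \<open>Rollouts and runs\<close>

lemma traj_return_Nil [simp]: "traj_return f h [] = 0"
  by (simp add: traj_return_def)

lemma traj_return_Cons [simp]:
  "traj_return f h ((s, a, s') # tr) = f h s a + traj_return f (Suc h) tr"
  by (simp add: traj_return_def sum.lessThan_Suc_shift del: sum.lessThan_Suc)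

lemma matches_snoc:
  "matches (hist @ [ep]) h s a
     = matches hist h s a @ (case ep ! (h - 1) of (x, y, s') \<Rightarrow> if x = s \<and> y = a then [(x, y, s')] else [])"
  by (simp add: matches_def data_h_def split: prod.split)

text \<open>The hypotheses of the theorem together with \<open>K \<ge> 1\<close>, which helps to
  make the argument of the logarithm at least 2; \<open>K = 0\<close> is treated separately at the
  end.\<close>

locale rsvi_setting =
  fixes S A H K :: nat and \<beta> \<delta> :: real
    and P :: "nat \<Rightarrow> nat \<Rightarrow> nat \<Rightarrow> nat pmf" and r :: "nat \<Rightarrow> nat \<Rightarrow> nat \<Rightarrow> real"
    and init :: "history \<Rightarrow> nat" and sel :: "(nat \<Rightarrow> real) \<Rightarrow> nat"
  assumes S_pos: "S \<ge> 1" and A_pos: "A \<ge> 1" and H_pos: "H \<ge> 1" and K_pos: "K \<ge> 1"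
    and beta_nz: "\<beta> \<noteq> 0" and delta_pos: "0 < \<delta>" and delta_le: "\<delta> \<le> 1"
    and P_supp: "\<And>h s a. 1 \<le> h \<Longrightarrow> h \<le> H \<Longrightarrow> s < S \<Longrightarrow> a < A \<Longrightarrow> set_pmf (P h s a) \<subseteq> {..<S}"
    and r_bounds: "\<And>h s a. 1 \<le> h \<Longrightarrow> h \<le> H \<Longrightarrow> s < S \<Longrightarrow> a < A \<Longrightarrow> 0 \<le> r h s a \<and> r h s a \<le> 1"
    and init_less: "\<And>hist. init hist < S"
    and sel_less: "\<And>f. sel f < A" and sel_max: "\<And>f a. a < A \<Longrightarrow> f a \<le> f (sel f)"
begin

definition "triples = {..<S} \<times> {..<A} \<times> {..<S}"
definition "episodes = {ep. set ep \<subseteq> triples \<and> length ep = H}"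

text \<open>From here on the bonus constant is 2 and \<open>T\<close> is \<open>K * H\<close>, also
  for runs of fewer than \<open>K\<close> episodes.\<close>

abbreviation "qval \<equiv> rsvi_Q H S A \<beta> 2 \<delta> (K * H) r"
abbreviation "vval \<equiv> rsvi_V H S A \<beta> 2 \<delta> (K * H) r"
abbreviation "greedy \<equiv> rsvi_policy H S A \<beta> 2 \<delta> (K * H) r sel"
abbreviation "run \<equiv> rsvi_run H S A \<beta> 2 \<delta> (K * H) r sel P init"

lemma P_finite: "1 \<le> h \<Longrightarrow> h \<le> H \<Longrightarrow> s < S \<Longrightarrow> a < A \<Longrightarrow> finite (set_pmf (P h s a))"
  by (rule finite_subset[OF P_supp]) auto

lemma P_less: "1 \<le> h \<Longrightarrow> h \<le> H \<Longrightarrow> s < S \<Longrightarrow> a < A \<Longrightarrow> s' \<in> set_pmf (P h s a) \<Longrightarrow> s' < S"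
  using P_supp by blast

lemma greedy_less: "greedy hist h s < A"
  by (simp add: rsvi_policy_def sel_less)

lemma finite_triples: "finite triples"
  by (simp add: triples_def)

context
  fixes \<pi> :: "nat \<Rightarrow> nat \<Rightarrow> nat"
  assumes pol: "\<And>h s. \<pi> h s < A"
begin

lemma rollout_support:
  assumes "1 \<le> h" "h + n \<le> Suc H" "s < S" "tr \<in> set_pmf (rollout P \<pi> h n s)"
  shows "set tr \<subseteq> triples \<and> length tr = n"
  using assms
proof (induction n arbitrary: h s tr)
  case (Suc n)
  from Suc.prems obtain s' tr' where tr: "tr = (s, \<pi> h s, s') # tr'"
    and s': "s' \<in> set_pmf (P h s (\<pi> h s))" and tr': "tr' \<in> set_pmf (rollout P \<pi> (Suc h) n s')"
    by auto
  have "s' < S" using P_less[OF _ _ _ pol s'] Suc.prems by simp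
  then show ?case
    using Suc.IH[OF _ _ _ tr'] Suc.prems pol by (auto simp: tr triples_def)
qed auto

lemma finite_rollout:
  assumes "1 \<le> h" "h + n \<le> Suc H" "s < S"
  shows "finite (set_pmf (rollout P \<pi> h n s))"
  by (rule finite_subset[OF _ finite_lists_length_eq[OF finite_triples, of n]])
    (use rollout_support[OF assms] in blast)

lemma expectation_rollout_Suc:
  fixes f :: "triple list \<Rightarrow> real"
  assumes "1 \<le> h" "h + n \<le> H" "s < S"
  shows "measure_pmf.expectation (rollout P \<pi> h (Suc n) s) f
    = measure_pmf.expectation (P h s (\<pi> h s)) (\<lambda>s'.
        measure_pmf.expectation (rollout P \<pi> (Suc h) n s') (\<lambda>tr. f ((s, \<pi> h s, s') # tr)))"
proof -
  have P: "finite (set_pmf (P h s (\<pi> h s)))" using P_finite pol assms by simp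
  have R: "finite (set_pmf (rollout P \<pi> (Suc h) n s'))" if "s' \<in> set_pmf (P h s (\<pi> h s))" for s'
    using P_less[OF _ _ _ pol that] assms by (intro finite_rollout) auto
  have "rollout P \<pi> h (Suc n) s = bind_pmf (P h s (\<pi> h s))
      (\<lambda>s'. map_pmf (\<lambda>tr. (s, \<pi> h s, s') # tr) (rollout P \<pi> (Suc h) n s'))"
    by (simp add: map_pmf_def)
  then show ?thesis
    by (simp only: expectation_bind_pmf_finite[OF P] R set_map_pmf finite_imageI integral_map_pmf)
qed

text \<open>Serves to estimate a factor attached to one step of an episode. Given the state and
  action of that step only its transition matters, and averaging over how the policy got there
  preserves the bound 1.\<close>

lemma expectation_rollout_nth_le_1:
  assumes g0: "\<And>x. 0 \<le> g x"
    and g: "\<And>s a. s < S \<Longrightarrow> a < A \<Longrightarrow> measure_pmf.expectation (P (h + i) s a) (\<lambda>s'. g (s, a, s')) \<le> 1"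
    and "1 \<le> h" "h + n \<le> Suc H" "s < S" "i < n"
  shows "measure_pmf.expectation (rollout P \<pi> h n s) (\<lambda>tr. g (tr ! i)) \<le> (1::real)"
  using assms
proof (induction n arbitrary: h s i)
  case (Suc n)
  have eq: "measure_pmf.expectation (rollout P \<pi> h (Suc n) s) (\<lambda>tr. g (tr ! i))
    = measure_pmf.expectation (P h s (\<pi> h s)) (\<lambda>s'.
        measure_pmf.expectation (rollout P \<pi> (Suc h) n s') (\<lambda>tr. g (((s, \<pi> h s, s') # tr) ! i)))"
    using Suc.prems by (intro expectation_rollout_Suc) auto
  show ?case
  proof (cases i)
    case 0
    then show ?thesis unfolding eq using Suc.prems(2)[of s "\<pi> h s"] Suc.prems pol by simp
  next
    \<comment> \<open>Passing from \<open>h\<close> to \<open>Suc h\<close> and from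
      \<open>i\<close> to \<open>j\<close> keeps the step \<open>h + i\<close> fixed, so the
      hypothesis on \<open>g\<close> is inherited.\<close>
    case (Suc j)
    have "measure_pmf.expectation (rollout P \<pi> (Suc h) n s') (\<lambda>tr. g (tr ! j)) \<le> 1"
      if "s' \<in> set_pmf (P h s (\<pi> h s))" for s'
      using Suc.prems P_less[OF _ _ _ pol that] \<open>i = Suc j\<close> by (intro Suc.IH) auto
    then show ?thesis unfolding eq using Suc.prems \<open>i = Suc j\<close> pol P_finite
      by (simp add: expectation_pmf_le)
  qed
qed simp

end

section \<open>Runs of the algorithm as a process over episodes\<close>

definition "next_episode hist = rollout P (greedy hist) 1 H (init hist)"

lemma next_episode_support: "ep \<in> set_pmf (next_episode hist) \<Longrightarrow> ep \<in> episodes"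
  using rollout_support[of "greedy hist" 1 H "init hist" ep] greedy_less init_less
  by (auto simp: episodes_def next_episode_def)

lemma finite_next_episode: "finite (set_pmf (next_episode hist))"
  unfolding next_episode_def using greedy_less init_less by (intro finite_rollout) auto

lemma run_Suc: "run (Suc k) = bind_pmf (run k) (\<lambda>hist. map_pmf (\<lambda>ep. hist @ [ep]) (next_episode hist))"
  by (simp add: map_pmf_def next_episode_def)

lemma run_support: "hist \<in> set_pmf (run k) \<Longrightarrow> set hist \<subseteq> episodes \<and> length hist = k"
proof (induction k arbitrary: hist)
  case (Suc k)
  then obtain hist' ep where "hist' \<in> set_pmf (run k)" "ep \<in> set_pmf (next_episode hist')"
    "hist = hist' @ [ep]"
    unfolding run_Suc by auto
  then show ?case using Suc.IH[of hist'] next_episode_support by simp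
qed simp

lemma finite_run: "finite (set_pmf (run k))"
proof (induction k)
  case (Suc k)
  then show ?case unfolding run_Suc by (simp add: finite_next_episode)
qed simp

text \<open>Later episodes are only appended and \<open>T\<close> is the same throughout, so shorter
  runs are marginals of longer ones. Events about the data before an episode can thus be estimated
  under the shorter run.\<close>

lemma map_take_run: "j \<le> k \<Longrightarrow> map_pmf (take j) (run k) = run j"
proof (induction k)
  case (Suc k)
  show ?case
  proof (cases "j = Suc k")
    case True
    have "map_pmf (take j) (run (Suc k)) = map_pmf id (run (Suc k))"
      using run_support[of _ "Suc k"] True by (intro map_pmf_cong refl) (simp del: rsvi_run.simps)
    then show ?thesis using True by (simp only: map_pmf_id id_apply)
  next
    case False
    then have "j \<le> k" using Suc.prems by simp
    have "map_pmf (take j) (run (Suc k))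
        = bind_pmf (run k) (\<lambda>hist. map_pmf (\<lambda>ep. take j hist) (next_episode hist))"
      unfolding run_Suc map_bind_pmf map_pmf_comp using run_support[of _ k] \<open>j \<le> k\<close>
      by (intro bind_pmf_cong refl) (simp add: run_support)
    also have "\<dots> = map_pmf (take j) (run k)"
      by (simp add: map_pmf_const) (simp add: map_pmf_def)
    finally show ?thesis using Suc.IH \<open>j \<le> k\<close> by simp
  qed
qed simp

text \<open>Iterated expectation: \<open>next_episode hist\<close> is the law of the next episode
  given the past. The one-step inequality is asked for well-formed histories, among which the
  support lies.\<close>

lemma run_supermartingale:
  fixes F :: "history \<Rightarrow> real"
  assumes "F [] \<le> 1"
    and "\<And>hist. set hist \<subseteq> episodes \<Longrightarrow>
           measure_pmf.expectation (next_episode hist) (\<lambda>ep. F (hist @ [ep])) \<le> F hist"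
  shows "measure_pmf.expectation (run k) F \<le> 1"
proof (induction k)
  case (Suc k)
  have "measure_pmf.expectation (run (Suc k)) F
      = measure_pmf.expectation (run k) (\<lambda>hist.
          measure_pmf.expectation (next_episode hist) (\<lambda>ep. F (hist @ [ep])))"
    unfolding run_Suc
    by (subst expectation_bind_pmf_finite) (simp_all add: finite_run finite_next_episode)
  also have "\<dots> \<le> measure_pmf.expectation (run k) F"
    using run_support by (intro expectation_pmf_mono finite_run assms(2)) blast
  finally show ?case using Suc by linarith
qed (use assms in simp)

section \<open>Concentration of the transition frequencies\<close>

definition "L = ln (2 * real S * real A * real (K * H) / \<delta>)"
text \<open>The bonus with constant 2 after \<open>n\<close> visits, divided by
  \<open>\<bar>exp (\<beta> * real H) - 1\<bar>\<close>.\<close>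

definition "eps n = 2 * sqrt (real S * L / real n)"
text \<open>Not divided by the count, so that each visit to \<open>(s, a)\<close> at step
  \<open>h\<close> simply adds one centred term.\<close>

definition "deviation hist h s a B
  = (\<Sum>(x, y, s') \<leftarrow> matches hist h s a. indicator B s' - measure_pmf.prob (P h s a) B)"
text \<open>One-sided bounds for all \<open>B\<close> suffice: on well-formed data the complement of
  \<open>B\<close> in \<open>{..<S}\<close> has the opposite deviation.\<close>

definition "good hist \<longleftrightarrow> (\<forall>h\<in>{1..H}. \<forall>s<S. \<forall>a<A. \<forall>B\<subseteq>{..<S}. count_N hist h s a \<ge> 1 \<longrightarrow>
   deviation hist h s a B \<le> count_N hist h s a * eps (count_N hist h s a))"

lemma SAT_ge_1: "1 \<le> real S * real A * real (K * H)"
proof -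
  have "1 \<le> S * A * (K * H)" using S_pos A_pos K_pos H_pos by (simp add: Suc_le_eq)
  then have "1 \<le> real (S * A * (K * H))" by linarith
  then show ?thesis by simp
qed

lemma log_arg_ge:
  "2 \<le> 2 * real S * real A * real (K * H) / \<delta>"
  "2 * (real S * real A * real (K * H)) \<le> 2 * real S * real A * real (K * H) / \<delta>"
proof -
  have "2 * (real S * real A * real (K * H)) \<le> 2 * (real S * real A * real (K * H)) / \<delta>"
    using delta_pos delta_le by (simp add: le_divide_eq mult_left_le)
  then show "2 \<le> 2 * real S * real A * real (K * H) / \<delta>"
    "2 * (real S * real A * real (K * H)) \<le> 2 * real S * real A * real (K * H) / \<delta>"
    using SAT_ge_1 by (simp_all only: mult.assoc)
qed

text \<open>Keeping \<open>L\<close> away from zero allows constants and \<open>sqrt L\<close> to be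
  absorbed into multiples of \<open>L\<close> later.\<close>

lemma L_ge: "L \<ge> 1 / 2"
proof -
  have "1 / 2 \<le> ln (2::real)" using ln2_ge_two_thirds by simp
  also have "\<dots> \<le> L" unfolding L_def using log_arg_ge(1) by (subst ln_le_cancel_iff) auto
  finally show ?thesis .
qed

lemma eps_pos: "n \<ge> 1 \<Longrightarrow> eps n > 0"
  unfolding eps_def using L_ge S_pos by (simp add: divide_pos_pos)

text \<open>An episode multiplies the process by a factor depending only on its triple at step
  \<open>h\<close>. The factor is 1 if that triple misses \<open>(s, a)\<close>; otherwise
  Hoeffding's lemma for an indicator costs at most \<open>exp (\<eta>\<^sup>2 / 8)\<close>, which
  the count term cancels.\<close>

lemma expectation_exp_deviation:
  assumes h: "1 \<le> h" "h \<le> H" and "s < S" "a < A" "\<eta> > 0"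
  shows "measure_pmf.expectation (run k)
    (\<lambda>hist. exp (\<eta> * deviation hist h s a B - \<eta>\<^sup>2 / 8 * count_N hist h s a)) \<le> 1"
proof (rule run_supermartingale)
  let ?p = "measure_pmf.prob (P h s a) B"
  let ?F = "\<lambda>hist. exp (\<eta> * deviation hist h s a B - \<eta>\<^sup>2 / 8 * count_N hist h s a)"
  define g where "g = (\<lambda>(x, y, s'). if x = s \<and> y = a
    then exp (\<eta> * (indicator B s' - ?p) - \<eta>\<^sup>2 / 8) else 1)"
  show "?F [] \<le> 1" by (simp add: deviation_def count_N_def matches_def data_h_def)
  fix hist
  have "?F (hist @ [ep]) = ?F hist * g (ep ! (h - 1))" for ep
  proof (cases "ep ! (h - 1)")
    case (fields x y s')
    show ?thesis
    proof (cases "x = s \<and> y = a")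
      case True
      then have d: "deviation (hist @ [ep]) h s a B = deviation hist h s a B + (indicator B s' - ?p)"
        and c: "count_N (hist @ [ep]) h s a = count_N hist h s a + 1"
        by (simp_all add: deviation_def count_N_def matches_snoc fields[simplified])
      show ?thesis unfolding d c using True
        by (simp add: g_def fields[simplified] field_simps flip: exp_add)
    next
      case False
      then show ?thesis by (auto simp: deviation_def count_N_def matches_snoc fields[simplified] g_def)
    qed
  qed
  moreover have "measure_pmf.expectation (next_episode hist) (\<lambda>ep. g (ep ! (h - 1))) \<le> 1"
    unfolding next_episode_def
  proof (rule expectation_rollout_nth_le_1)
    fix x y assume "x < S" "y < A"
    show "measure_pmf.expectation (P (1 + (h - 1)) x y) (\<lambda>s'. g (x, y, s')) \<le> 1"
    proof (cases "x = s \<and> y = a")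
      case True
      have "measure_pmf.expectation (P h s a) (\<lambda>s'. g (s, a, s'))
         = measure_pmf.expectation (P h s a)
            (\<lambda>s'. exp (\<eta> * (indicator B s' - measure_pmf.expectation (P h s a) (indicator B))))
             * exp (- (\<eta>\<^sup>2 / 8))"
      proof -
        have "g (s, a, s') = exp (\<eta> * (indicator B s' - ?p)) * exp (- (\<eta>\<^sup>2 / 8))" for s'
          by (simp add: g_def flip: exp_add)
        then show ?thesis by simp
      qed
      also have "\<dots> \<le> exp (\<eta>\<^sup>2 * (1 - 0)\<^sup>2 / 8) * exp (- (\<eta>\<^sup>2 / 8))"
        by (intro mult_right_mono Hoeffdings_lemma_pmf P_finite assms)
           (auto simp: indicator_def)
      also have "\<dots> = 1" by (simp flip: exp_add)
      finally show ?thesis using True h by simp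
    qed (auto simp: g_def)
  qed (use h greedy_less init_less in \<open>auto simp: g_def\<close>)
  ultimately show "measure_pmf.expectation (next_episode hist) (\<lambda>ep. ?F (hist @ [ep])) \<le> ?F hist"
    by (simp add: mult_left_le)
qed

text \<open>A Chernoff bound. The count is random while \<open>\<eta>\<close> must be a fixed
  number, hence one event for each value \<open>n\<close> of the count.\<close>

lemma prob_large_deviation:
  assumes "1 \<le> h" "h \<le> H" "s < S" "a < A" "n \<ge> 1"
  shows "measure_pmf.prob (run k)
    {hist. count_N hist h s a = n \<and> n * eps n < deviation hist h s a B} \<le> exp (- (8 * real S * L))"
proof -
  \<comment> \<open>Maximizes \<open>\<eta> * (n * eps n) - \<eta>\<^sup>2 / 8 * n\<close>; the
    maximum \<open>2 * n * (eps n)\<^sup>2\<close> equals \<open>8 * S * L\<close>.\<close>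
  let ?\<eta> = "4 * eps n"
  have sq: "(eps n)\<^sup>2 = 4 * (S * L / n)"
    using L_ge by (simp add: eps_def power_mult_distrib)
  have "measure_pmf.prob (run k)
    {hist. count_N hist h s a = n \<and> n * eps n < deviation hist h s a B} \<le> 1 / exp (8 * real S * L)"
  proof (rule pmf_exponential_Markov[OF finite_run _
        expectation_exp_deviation[OF assms(1-4), of ?\<eta> k B]])
    fix hist assume "hist \<in> {hist. count_N hist h s a = n \<and> n * eps n < deviation hist h s a B}"
    then have n: "count_N hist h s a = n" and d: "n * eps n < deviation hist h s a B" by auto
    have "8 * real S * L = ?\<eta> * (n * eps n) - ?\<eta>\<^sup>2 / 8 * n"
    proof -
      have "?\<eta> * (n * eps n) - ?\<eta>\<^sup>2 / 8 * n = 2 * n * (eps n)\<^sup>2"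
        by (simp add: power2_eq_square)
      then show ?thesis using \<open>n \<ge> 1\<close> by (simp add: sq)
    qed
    also have "\<dots> \<le> ?\<eta> * deviation hist h s a B - ?\<eta>\<^sup>2 / 8 * n"
      using d eps_pos[OF \<open>n \<ge> 1\<close>] by simp
    finally show "exp (8 * real S * L) \<le> exp (?\<eta> * deviation hist h s a B - ?\<eta>\<^sup>2 / 8 * count_N hist h s a)"
      using n by simp
  qed (use eps_pos[OF \<open>n \<ge> 1\<close>] in auto)
  then show ?thesis by (simp add: exp_minus field_simps)
qed

section \<open>Union bound for the good event\<close>

lemma prob_take_run:
  assumes "k \<le> K"
  shows "measure_pmf.prob (run K) {hist. take k hist \<in> E} = measure_pmf.prob (run k) E"
proof -
  have "measure_pmf.prob (run k) E = measure_pmf.prob (map_pmf (take k) (run K)) E"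
    using map_take_run[OF assms] by simp
  then show ?thesis by (simp add: measure_map_pmf vimage_def)
qed

lemma count_N_le_length: "count_N hist h s a \<le> length hist"
  unfolding count_N_def matches_def data_h_def by (rule order.trans[OF length_filter_le]) simp

lemma exp_minus_L: "exp (- L) = 1 / (2 * real S * real A * real (K * H) / \<delta>)"
proof -
  have "0 < 2 * real S * real A * real (K * H) / \<delta>" using log_arg_ge(1) by linarith
  then show ?thesis unfolding L_def by (simp only: exp_minus exp_ln inverse_eq_divide)
qed

lemma exp_minus_L_le: "exp (- L) \<le> \<delta> / 2"
proof -
  have "2 * 1 / \<delta> \<le> 2 * (real S * real A * real (K * H)) / \<delta>"
    using delta_pos SAT_ge_1 by (intro divide_right_mono mult_left_mono) auto
  then have "2 / \<delta> \<le> 2 * real S * real A * real (K * H) / \<delta>" by (simp add: mult.assoc)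
  then have "exp (- L) \<le> 1 / (2 / \<delta>)"
    unfolding exp_minus_L using delta_pos log_arg_ge(1) by (intro divide_left_mono mult_pos_pos) auto
  then show ?thesis by simp
qed

text \<open>With \<open>x = exp L\<close>, there are at most \<open>x ^ (S + 2)\<close> events, each
  of probability at most \<open>(1 / x) ^ (8 * S)\<close>. As \<open>S \<ge> 1\<close> gives
  \<open>S + 2 \<le> 8 * S - 1\<close>, a factor \<open>1 / x\<close> is left, which is at most
  \<open>\<delta> / 2\<close>.\<close>

lemma union_bound_arith:
  "real K * (real H * (real S * (real A * (2 ^ S * real K)))) * exp (- (8 * real S * L)) \<le> \<delta> / 2"
proof -
  define x where "x = 2 * real S * real A * real (K * H) / \<delta>"
  have x2: "2 \<le> x" and xT: "2 * (real S * real A * real (K * H)) \<le> x"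
    using log_arg_ge unfolding x_def by auto
  have SAH: "1 \<le> real S * real A * real H"
    using S_pos A_pos H_pos by (metis mult_le_mono nat_mult_1 of_nat_1 of_nat_le_iff of_nat_mult)
  have Kx: "real K \<le> x"
  proof -
    have "real K * 1 \<le> real K * (real S * real A * real H)" using SAH by (intro mult_left_mono) auto
    also have "\<dots> = real S * real A * real (K * H)" by (simp add: mult_ac)
    also have "\<dots> \<le> 2 * (real S * real A * real (K * H))" by simp
    finally show ?thesis using xT by simp
  qed
  have ex: "exp (- (8 * real S * L)) = (1 / x) ^ (8 * S)"
  proof -
    have "exp (- (8 * real S * L)) = exp (- L) ^ (8 * S)" by (simp add: mult_ac flip: exp_of_nat_mult)
    moreover have "exp (- L) = 1 / x" by (simp only: exp_minus_L x_def)
    ultimately show ?thesis by simp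
  qed
  have "real K * (real H * (real S * (real A * (2 ^ S * real K))))
      = (real S * real A * real (K * H)) * real K * 2 ^ S" by (simp add: algebra_simps)
  also have "\<dots> \<le> x * x * x ^ S"
    using x2 xT Kx by (intro mult_mono power_mono) auto
  also have "\<dots> = x ^ (S + 2)" by (simp add: power_add power2_eq_square)
  finally have "real K * (real H * (real S * (real A * (2 ^ S * real K)))) * exp (- (8 * real S * L))
      \<le> x ^ (S + 2) * (1 / x) ^ (8 * S)"
    unfolding ex using x2 by (intro mult_right_mono) auto
  also have "\<dots> \<le> x ^ (8 * S - 1) * (1 / x) ^ (8 * S)"
    using x2 S_pos by (intro mult_right_mono power_increasing) auto
  also have "\<dots> = 1 / x"
    using x2 S_pos power_Suc[of x "8 * S - 1"] by (simp add: power_one_over)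
  also have "\<dots> \<le> \<delta> / 2" using exp_minus_L exp_minus_L_le by (simp only: x_def)
  finally show ?thesis .
qed

lemma prob_not_good:
  "measure_pmf.prob (run K) {hist. \<exists>k<K. \<not> good (take k hist)} \<le> \<delta> / 2"
proof -
  \<comment> \<open>The indices are the number of past episodes, the step, the pair, the set of
    states, and the value of the count.\<close>
  let ?I = "{..<K} \<times> {1..H} \<times> {..<S} \<times> {..<A} \<times> Pow {..<S} \<times> {1..K}"
  let ?E = "\<lambda>(k, h, s, a, B, n).
    {hist. take k hist \<in> {hist. count_N hist h s a = n \<and> n * eps n < deviation hist h s a B}}"
  have "{hist. \<exists>k<K. \<not> good (take k hist)} \<subseteq> (\<Union>i\<in>?I. ?E i)"
  proof clarify
    fix hist k assume "k < K" "\<not> good (take k hist)"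
    then obtain h s a B where *: "h \<in> {1..H}" "s < S" "a < A" "B \<subseteq> {..<S}"
      "count_N (take k hist) h s a \<ge> 1"
      "count_N (take k hist) h s a * eps (count_N (take k hist) h s a) < deviation (take k hist) h s a B"
      unfolding good_def by (auto simp: not_le)
    have "count_N (take k hist) h s a \<le> K"
      using count_N_le_length[of "take k hist" h s a] \<open>k < K\<close> by simp
    with * \<open>k < K\<close> have "(k, h, s, a, B, count_N (take k hist) h s a) \<in> ?I" by auto
    moreover have "hist \<in> ?E (k, h, s, a, B, count_N (take k hist) h s a)" using * by simp
    ultimately show "hist \<in> (\<Union>i\<in>?I. ?E i)" by (rule UN_I)
  qed
  then have "measure_pmf.prob (run K) {hist. \<exists>k<K. \<not> good (take k hist)}
      \<le> measure_pmf.prob (run K) (\<Union>i\<in>?I. ?E i)"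
    by (intro measure_pmf.finite_measure_mono) auto
  also have "\<dots> \<le> (\<Sum>i\<in>?I. measure_pmf.prob (run K) (?E i))"
    by (intro measure_pmf.finite_measure_subadditive_finite) auto
  also have "\<dots> \<le> (\<Sum>i\<in>?I. exp (- (8 * real S * L)))"
  proof (rule sum_mono)
    fix i assume "i \<in> ?I"
    then obtain k h s a B n where i: "i = (k, h, s, a, B, n)"
      and "k < K" "h \<in> {1..H}" "s < S" "a < A" "n \<in> {1..K}"
      by auto
    then show "measure_pmf.prob (run K) (?E i) \<le> exp (- (8 * real S * L))"
      unfolding i prod.case
      by (subst prob_take_run) (use prob_large_deviation[of h s a n k B] in auto)
  qed
  also have "\<dots> = real K * (real H * (real S * (real A * (2 ^ S * real K)))) * exp (- (8 * real S * L))"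
    by (simp add: card_cartesian_product card_Pow)
  finally show ?thesis using union_bound_arith by linarith
qed

section \<open>Optimism and the regret of one episode\<close>

definition "G = \<bar>exp (\<beta> * real H) - 1\<bar>"
text \<open>\<open>G * psi\<close> is twice the bonus, capped at the range \<open>G\<close> of \<open>exp (\<beta> * value)\<close>; the cap makes
  it bounded as the supermartingale over episodes requires.\<close>
definition "psi hist h s a
  = (if count_N hist h s a = 0 then 1 else min 1 (4 * sqrt (S * L) / sqrt (count_N hist h s a)))"

lemma G_nonneg: "0 \<le> G" by (simp add: G_def)

lemma psi_bounds: "0 \<le> psi hist h s a" "psi hist h s a \<le> 1"
  using L_ge by (auto simp: psi_def)

lemma matches_subset_triples:
  assumes "set hist \<subseteq> episodes" "1 \<le> h" "h \<le> H"
  shows "set (matches hist h s a) \<subseteq> triples"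
proof -
  have "ep ! (h - 1) \<in> triples" if "ep \<in> set hist" for ep
  proof -
    have "ep \<in> episodes" using assms(1) that by blast
    then have "set ep \<subseteq> triples" "h - 1 < length ep" using assms by (auto simp: episodes_def)
    then show ?thesis using nth_mem[of "h - 1" ep] by blast
  qed
  then show ?thesis by (auto simp: matches_def data_h_def)
qed

text \<open>On a good history this holds for all \<open>f\<close> at once, so \<open>f\<close> may
  be computed from the same data. The weights \<open>d\<close>, observed minus expected counts of
  next states, have \<open>deviation\<close> as their sum over a set, so
  \<open>deviation_of_bounded_function\<close> applies.\<close>

lemma empirical_mean_close:
  fixes f :: "nat \<Rightarrow> real"
  assumes hist: "set hist \<subseteq> episodes" "good hist" and h: "1 \<le> h" "h \<le> H" and "s < S" "a < A"
    and n: "n = count_N hist h s a" "n \<noteq> 0"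
    and f: "\<And>s'. s' < S \<Longrightarrow> f s' \<in> {l..u}" and "l \<le> u"
  shows "\<bar>(\<Sum>(x, y, s') \<leftarrow> matches hist h s a. f s') / n - measure_pmf.expectation (P h s a) f\<bar>
     \<le> (u - l) * eps n"
proof -
  define xs where "xs = map (snd \<circ> snd) (matches hist h s a)"
  define d where "d = (\<lambda>s'. real (count_list xs s') - n * pmf (P h s a) s')"
  have P: "set_pmf (P h s a) \<subseteq> {..<S}" using P_supp assms by auto
  have xs: "set xs \<subseteq> {..<S}"
    using matches_subset_triples[OF hist(1) h, of s a] by (auto simp: xs_def triples_def)
  have len: "length xs = n" by (simp add: xs_def n count_N_def)
  have sum_d: "(\<Sum>s'<S. d s' * g s') = sum_list (map g xs) - n * measure_pmf.expectation (P h s a) g"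
    for g :: "nat \<Rightarrow> real"
    unfolding sum_list_map_eq_sum_count_real[OF finite_lessThan xs]
      expectation_eq_sum_pmf[OF finite_lessThan P]
    by (simp add: d_def left_diff_distrib sum_subtractf sum_distrib_left mult.assoc)
  have eq: "(\<Sum>(x, y, s') \<leftarrow> matches hist h s a. g s') = sum_list (map g xs)" for g :: "nat \<Rightarrow> real"
    by (simp add: xs_def o_def case_prod_unfold)
  have "\<bar>\<Sum>s'<S. d s' * f s'\<bar> \<le> (u - l) * (n * eps n)"
  proof (rule deviation_of_bounded_function)
    \<comment> \<open>Observed and expected counts both total \<open>n\<close>.\<close>
    show "sum d {..<S} = 0"
      using sum_d[of "\<lambda>_. 1"] len by (simp add: sum_list_triv)
    fix B :: "nat set" assume B: "B \<subseteq> {..<S}"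
    have "sum d B = (\<Sum>s'<S. d s' * indicator B s')"
      using B by (simp add: indicator_def if_distrib sum.If_cases Int_absorb1 cong: if_cong)
    also have "\<dots> = deviation hist h s a B"
      unfolding sum_d deviation_def eq by (simp add: sum_list_subtractf sum_list_triv len)
    also have "\<dots> \<le> n * eps n"
      using hist(2) B n h \<open>s < S\<close> \<open>a < A\<close> by (auto simp: good_def)
    finally show "sum d B \<le> n * eps n" .
  qed (use f \<open>l \<le> u\<close> in auto)
  then have "\<bar>sum_list (map f xs) - n * measure_pmf.expectation (P h s a) f\<bar> \<le> (u - l) * (n * eps n)"
    unfolding sum_d .
  moreover have "sum_list (map f xs) / n - measure_pmf.expectation (P h s a) f
      = (sum_list (map f xs) - n * measure_pmf.expectation (P h s a) f) / n"
    using n by (simp add: diff_divide_distrib)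
  ultimately show ?thesis
    unfolding eq using n by (simp add: abs_divide divide_le_eq mult_ac)
qed

lemma exp_mult_cases:
  assumes "0 \<le> x" "x \<le> y" "y \<le> real H"
  shows "\<beta> > 0 \<Longrightarrow> 1 \<le> exp (\<beta> * x) \<and> exp (\<beta> * x) \<le> exp (\<beta> * y) \<and> exp (\<beta> * y) \<le> 1 + G"
    and "\<beta> < 0 \<Longrightarrow> exp (\<beta> * x) \<le> 1 \<and> exp (\<beta> * y) \<le> exp (\<beta> * x) \<and> 1 - G \<le> exp (\<beta> * y)"
proof -
  assume \<beta>: "\<beta> > 0"
  then have "1 \<le> exp (\<beta> * real H)" by simp
  moreover have "exp (\<beta> * y) \<le> exp (\<beta> * real H)" using \<beta> assms by simp
  ultimately show "1 \<le> exp (\<beta> * x) \<and> exp (\<beta> * x) \<le> exp (\<beta> * y) \<and> exp (\<beta> * y) \<le> 1 + G"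
    using assms \<beta> by (auto simp: G_def)
next
  assume \<beta>: "\<beta> < 0"
  then have "exp (\<beta> * real H) \<le> 1" by (simp add: mult_nonpos_nonneg)
  moreover have "exp (\<beta> * real H) \<le> exp (\<beta> * y)" using \<beta> assms by simp
  ultimately show "exp (\<beta> * x) \<le> 1 \<and> exp (\<beta> * y) \<le> exp (\<beta> * x) \<and> 1 - G \<le> exp (\<beta> * y)"
    using assms \<beta> by (auto simp: G_def mult_nonpos_nonneg)
qed

text \<open>One backup on the exponential scale; \<open>sgn \<beta>\<close> treats both signs
  together. The empirical mean is within one bonus of \<open>e\<close>, so shifting it
  optimistically by a bonus leaves an excess between 0 and two bonuses. Truncation is harmless
  because \<open>e\<close> does not pass the truncation level.\<close>

lemma Qstep_bounds:
  assumes hist: "set hist \<subseteq> episodes" "good hist" and h: "1 \<le> h" "h \<le> H" and sa: "s < S" "a < A"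
    and v: "\<And>s'. s' < S \<Longrightarrow> 0 \<le> v s' \<and> v s' \<le> real H - real h"
  defines "q \<equiv> rsvi_Qstep H S A \<beta> 2 \<delta> (K * H) r hist h v s a"
    and "e \<equiv> measure_pmf.expectation (P h s a) (\<lambda>s'. exp (\<beta> * (r h s a + v s')))"
  shows "0 \<le> q" "q \<le> real H - real h + 1"
    "0 \<le> sgn \<beta> * (exp (\<beta> * q) - e)" "sgn \<beta> * (exp (\<beta> * q) - e) \<le> G * psi hist h s a"
proof -
  define n where "n = count_N hist h s a"
  define cap where "cap = exp (\<beta> * (real H - real h + 1))"
  define w where "w = (\<Sum>(x, y, s') \<leftarrow> matches hist h s a. exp (\<beta> * (r h s a + v s'))) / n"
  define b where "b = G * eps n"
  have b: "b = 2 * G * sqrt (real S * L / real n)" by (simp add: b_def eps_def)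
  have q: "q = (if n = 0 then real H - real h + 1 else if \<beta> > 0 then (1 / \<beta>) * ln (min cap (w + b))
      else (1 / \<beta>) * ln (max cap (w - b)))"
    by (simp only: q_def rsvi_Qstep_def Let_def n_def cap_def w_def b G_def L_def)
  have x: "0 \<le> r h s a + v s'" "r h s a + v s' \<le> real H - real h + 1" if "s' < S" for s'
    using v[OF that] r_bounds[OF h sa] by auto
  have hH: "real H - real h + 1 \<le> real H" using h by simp
  have P: "finite (set_pmf (P h s a))" "\<And>s'. s' \<in> set_pmf (P h s a) \<Longrightarrow> s' < S"
    using P_finite[OF h sa] P_less[OF h sa] by auto
  have psi: "G * psi hist h s a = (if n = 0 then G else min G (2 * b))"
    using G_nonneg by (simp add: psi_def n_def b_def eps_def real_sqrt_divide min_mult_distrib_left mult.left_commute)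
  have "(0 \<le> q \<and> q \<le> real H - real h + 1) \<and>
    0 \<le> sgn \<beta> * (exp (\<beta> * q) - e) \<and> sgn \<beta> * (exp (\<beta> * q) - e) \<le> G * psi hist h s a"
  proof (cases "\<beta> > 0")
    case True
    have f: "exp (\<beta> * (r h s a + v s')) \<in> {1..cap}" if "s' < S" for s'
      using exp_mult_cases(1)[OF x[OF that] hH True] by (simp add: cap_def)
    have cap: "1 \<le> cap" "cap \<le> 1 + G"
      using exp_mult_cases(1)[OF _ _ hH True, of 0] h by (auto simp: cap_def)
    have e: "1 \<le> e" "e \<le> cap" unfolding e_def
      using f P by (auto intro!: expectation_pmf_le expectation_pmf_ge)
    show ?thesis
    proof (cases "n = 0")
      \<comment> \<open>Before the first visit \<open>q\<close> is the largest possible value, and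
        the excess is bounded only by the whole range \<open>G\<close>.\<close>
      case True
      then show ?thesis using \<open>\<beta> > 0\<close> e cap h by (simp add: q psi flip: cap_def)
    next
      case False
      \<comment> \<open>The range is widened from \<open>cap\<close> to \<open>1 + G\<close>, since
        the bonus is scaled by \<open>G\<close> at every step.\<close>
      have "\<bar>w - e\<bar> \<le> (1 + G - 1) * eps n" unfolding w_def e_def
        using f cap by (intro empirical_mean_close hist h sa n_def False) force+
      then have w: "e \<le> w + b" "w + b \<le> e + 2 * b" unfolding b_def by (auto simp: abs_le_iff)
      define m where "m = min cap (w + b)"
      have m: "1 \<le> m" "m \<le> cap" "e \<le> m" "m - e \<le> G" "m - e \<le> 2 * b"
        using w e cap by (auto simp: m_def)
      have \<beta>q: "\<beta> * q = ln m" using \<open>\<beta> > 0\<close> False by (simp add: q m_def)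
      have "0 \<le> \<beta> * q" using m by (simp add: \<beta>q)
      moreover have "\<beta> * q \<le> \<beta> * (real H - real h + 1)"
        using m ln_mono[of m cap] unfolding \<beta>q by (simp add: cap_def)
      moreover have "exp (\<beta> * q) = m" using m by (simp add: \<beta>q)
      ultimately show ?thesis using m False \<open>\<beta> > 0\<close> by (simp add: psi zero_le_mult_iff)
    qed
  next
    case False
    then have \<beta>: "\<beta> < 0" using beta_nz by simp
    have f: "exp (\<beta> * (r h s a + v s')) \<in> {cap..1}" if "s' < S" for s'
      using exp_mult_cases(2)[OF x[OF that] hH \<beta>] by (simp add: cap_def)
    have cap: "cap \<le> 1" "1 - G \<le> cap" "cap > 0"
      using exp_mult_cases(2)[OF _ _ hH \<beta>, of "real H - real h + 1"] h by (auto simp: cap_def)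
    have e: "e \<le> 1" "cap \<le> e" unfolding e_def
      using f P by (auto intro!: expectation_pmf_le expectation_pmf_ge)
    show ?thesis
    proof (cases "n = 0")
      case True
      then show ?thesis using \<beta> e cap h by (simp add: q psi flip: cap_def)
    next
      case False
      have "\<bar>w - e\<bar> \<le> (1 - (1 - G)) * eps n" unfolding w_def e_def
        using f cap by (intro empirical_mean_close hist h sa n_def False) force+
      then have w: "w - b \<le> e" "e - 2 * b \<le> w - b" unfolding b_def by (auto simp: abs_le_iff)
      \<comment> \<open>\<open>w - b\<close> may be negative; the maximum with
        \<open>cap > 0\<close> keeps the argument of the logarithm positive.\<close>
      define m where "m = max cap (w - b)"
      have m: "0 < m" "m \<le> 1" "cap \<le> m" "m \<le> e" "e - m \<le> G" "e - m \<le> 2 * b"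
        using w e cap by (auto simp: m_def)
      have \<beta>q: "\<beta> * q = ln m" using \<beta> False by (simp add: q m_def)
      have "\<beta> * q \<le> 0" using m by (simp add: \<beta>q)
      moreover have "\<beta> * (real H - real h + 1) \<le> \<beta> * q"
        using m ln_mono[of cap m] unfolding \<beta>q by (simp add: cap_def)
      moreover have "exp (\<beta> * q) = m" using m by (simp add: \<beta>q)
      ultimately show ?thesis using m False \<beta> by (simp add: psi mult_le_0_iff)
    qed
  qed
  then show "0 \<le> q" "q \<le> real H - real h + 1"
    "0 \<le> sgn \<beta> * (exp (\<beta> * q) - e)" "sgn \<beta> * (exp (\<beta> * q) - e) \<le> G * psi hist h s a"
    by auto
qed

section \<open>Exponential values and expected bonuses along trajectories\<close>

definition "exp_value \<pi> h n s
  = measure_pmf.expectation (rollout P \<pi> h n s) (\<lambda>tr. exp (\<beta> * traj_return r h tr))"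
text \<open>Reuses \<open>traj_return\<close> with \<open>psi hist\<close> as the reward function;
  the data stay frozen at \<open>hist\<close>.\<close>

definition "bonus_sum hist \<pi> h n s
  = measure_pmf.expectation (rollout P \<pi> h n s) (traj_return (psi hist) h)"

lemma exp_value_Suc:
  assumes "\<And>h s. \<pi> h s < A" "1 \<le> h" "h + n \<le> H" "s < S"
  shows "exp_value \<pi> h (Suc n) s
    = exp (\<beta> * r h s (\<pi> h s)) * measure_pmf.expectation (P h s (\<pi> h s)) (exp_value \<pi> (Suc h) n)"
  unfolding exp_value_def using assms
  by (subst expectation_rollout_Suc) (simp_all add: distrib_left exp_add)

lemma bonus_sum_Suc:
  assumes pol: "\<And>h s. \<pi> h s < A" and "1 \<le> h" "h + n \<le> H" "s < S"
  shows "bonus_sum hist \<pi> h (Suc n) s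
    = psi hist h s (\<pi> h s) + measure_pmf.expectation (P h s (\<pi> h s)) (bonus_sum hist \<pi> (Suc h) n)"
proof -
  have P: "finite (set_pmf (P h s (\<pi> h s)))" using P_finite pol assms by simp
  have "bonus_sum hist \<pi> h (Suc n) s = measure_pmf.expectation (P h s (\<pi> h s))
      (\<lambda>s'. psi hist h s (\<pi> h s) + bonus_sum hist \<pi> (Suc h) n s')"
    unfolding bonus_sum_def
  proof (subst expectation_rollout_Suc[OF pol], goal_cases)
    case 4
    show ?case
    proof (rule expectation_pmf_cong)
      fix s' assume s': "s' \<in> set_pmf (P h s (\<pi> h s))"
      have "finite (set_pmf (rollout P \<pi> (Suc h) n s'))"
        using P_less[OF _ _ _ pol s'] assms by (intro finite_rollout) auto
      then show "measure_pmf.expectation (rollout P \<pi> (Suc h) n s')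
          (\<lambda>tr. traj_return (psi hist) h ((s, \<pi> h s, s') # tr))
        = psi hist h s (\<pi> h s)
          + measure_pmf.expectation (rollout P \<pi> (Suc h) n s') (traj_return (psi hist) (Suc h))"
        by (simp add: integrable_measure_pmf_finite)
    qed
  qed (use assms in auto)
  then show ?thesis using P by (simp add: integrable_measure_pmf_finite)
qed

lemma traj_return_psi_bounds:
  "0 \<le> traj_return (psi hist) h tr" "traj_return (psi hist) h tr \<le> length tr"
  using psi_bounds sum_mono[of "{..<length tr}" "\<lambda>i. psi hist (h + i) (fst (tr ! i)) (fst (snd (tr ! i)))" "\<lambda>_. 1"]
  by (auto simp: traj_return_def intro: sum_nonneg)

lemma bonus_sum_nonneg: "0 \<le> bonus_sum hist \<pi> h n s"
  unfolding bonus_sum_def by (intro Bochner_Integration.integral_nonneg traj_return_psi_bounds)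

declare rsvi_V.simps(2) [simp del]

text \<open>\<open>vval\<close> is indexed by remaining steps, so \<open>Suc m\<close> belongs to
  step \<open>H - m\<close>. By \<open>sel_max\<close> the maximum is attained at the action that
  the algorithm really takes.\<close>

lemma vval_Suc:
  assumes "m < H"
  shows "vval hist (Suc m) s = qval hist (H - m) s (greedy hist (H - m) s)"
    and "a < A \<Longrightarrow> qval hist (H - m) s a \<le> vval hist (Suc m) s"
proof -
  have eq: "vval hist (Suc m) s = Max ((\<lambda>a. qval hist (H - m) s a) ` {..<A})"
    using assms by (simp add: rsvi_Q_def rsvi_V.simps(2))
  show "vval hist (Suc m) s = qval hist (H - m) s (greedy hist (H - m) s)"
    unfolding eq using sel_max[of _ "qval hist (H - m) s"] sel_less
    by (intro Max_eqI) (auto simp: rsvi_policy_def)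
  show "a < A \<Longrightarrow> qval hist (H - m) s a \<le> vval hist (Suc m) s"
    unfolding eq by (intro Max_ge) auto
qed

text \<open>For negative \<open>\<beta>\<close> the exponential reverses the order and the sign
  restores it; this is why exponential values are compared with the factor
  \<open>sgn \<beta>\<close>.\<close>

lemma sgn_exp_mono: "x \<le> y \<Longrightarrow> sgn \<beta> * exp (\<beta> * x) \<le> sgn \<beta> * exp (\<beta> * y)"
  using beta_nz by (cases "\<beta> > 0") auto

context
  fixes hist :: history
  assumes hist: "set hist \<subseteq> episodes" "good hist"
begin

lemma vval_bounds: "m \<le> H \<Longrightarrow> s < S \<Longrightarrow> 0 \<le> vval hist m s \<and> vval hist m s \<le> m"
proof (induction m arbitrary: s)
  case (Suc m)
  let ?h = "H - m"
  have "0 \<le> qval hist ?h s (greedy hist ?h s) \<and>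
        qval hist ?h s (greedy hist ?h s) \<le> real H - real ?h + 1"
    unfolding rsvi_Q_def using Suc
    by (intro conjI Qstep_bounds hist greedy_less) auto
  then show ?case using vval_Suc(1)[of m hist s] Suc.prems by simp
qed simp

lemma qval_bounds:
  assumes "m < H" "s < S" "a < A"
  defines "e \<equiv> exp (\<beta> * r (H - m) s a)
    * measure_pmf.expectation (P (H - m) s a) (\<lambda>s'. exp (\<beta> * vval hist m s'))"
  shows "0 \<le> sgn \<beta> * (exp (\<beta> * qval hist (H - m) s a) - e)"
    and "sgn \<beta> * (exp (\<beta> * qval hist (H - m) s a) - e) \<le> G * psi hist (H - m) s a"
proof -
  have e: "e = measure_pmf.expectation (P (H - m) s a) (\<lambda>s'. exp (\<beta> * (r (H - m) s a + vval hist m s')))"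
    by (simp add: e_def distrib_left exp_add)
  have *: "H - (H - m) = m" using assms by simp
  have v: "0 \<le> vval hist m s' \<and> vval hist m s' \<le> real H - real (H - m)" if "s' < S" for s'
    using vval_bounds[of m s'] that assms by simp
  show "0 \<le> sgn \<beta> * (exp (\<beta> * qval hist (H - m) s a) - e)"
    "sgn \<beta> * (exp (\<beta> * qval hist (H - m) s a) - e) \<le> G * psi hist (H - m) s a"
    unfolding e rsvi_Q_def * using assms hist v by (intro Qstep_bounds; simp)+
qed

text \<open>Backward induction: the Bellman equation of \<open>\<pi>\<close>, the induction
  hypothesis, the lower bound in \<open>qval_bounds\<close>, then maximization over actions. The
  good event does not mention \<open>\<pi>\<close>, so all policies are covered at once.\<close>

lemma optimism:
  assumes pol: "\<And>h s. \<pi> h s < A"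
  shows "m \<le> H \<Longrightarrow> s < S \<Longrightarrow>
    sgn \<beta> * exp_value \<pi> (Suc H - m) m s \<le> sgn \<beta> * exp (\<beta> * vval hist m s)"
proof (induction m arbitrary: s)
  case 0
  then show ?case by (simp add: exp_value_def)
next
  case (Suc m)
  define h where "h = H - m"
  have h: "Suc H - Suc m = h" "Suc H - m = Suc h" "1 \<le> h" "h + m \<le> H" "h \<le> H"
    using Suc.prems by (auto simp: h_def)
  have P: "finite (set_pmf (P h s (\<pi> h s)))" "\<And>s'. s' \<in> set_pmf (P h s (\<pi> h s)) \<Longrightarrow> s' < S"
    using P_finite[OF h(3,5) _ pol] P_less[OF h(3,5) _ pol] Suc.prems by auto
  have "sgn \<beta> * exp_value \<pi> h (Suc m) s = exp (\<beta> * r h s (\<pi> h s))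
      * measure_pmf.expectation (P h s (\<pi> h s)) (\<lambda>s'. sgn \<beta> * exp_value \<pi> (Suc h) m s')"
    using exp_value_Suc[OF pol h(3,4)] Suc.prems by simp
  also have "\<dots> \<le> exp (\<beta> * r h s (\<pi> h s))
      * measure_pmf.expectation (P h s (\<pi> h s)) (\<lambda>s'. sgn \<beta> * exp (\<beta> * vval hist m s'))"
    using Suc.IH P Suc.prems unfolding h by (intro mult_left_mono[OF expectation_pmf_mono]) auto
  also have "\<dots> \<le> sgn \<beta> * exp (\<beta> * qval hist h s (\<pi> h s))"
    using qval_bounds(1)[of m s "\<pi> h s"] Suc.prems pol
    by (simp add: right_diff_distrib mult.left_commute flip: h_def)
  also have "\<dots> \<le> sgn \<beta> * exp (\<beta> * vval hist (Suc m) s)"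
    using vval_Suc(2)[of m "\<pi> h s" hist s] Suc.prems pol unfolding h_def
    by (intro sgn_exp_mono) auto
  finally show ?case unfolding h .
qed

text \<open>The greedy action attains the estimated value, so each step adds at most
  \<open>G * psi\<close> to the error of the next step, which is multiplied by
  \<open>exp (\<beta> * r)\<close>. That factor is at most \<open>exp (max \<beta> 0)\<close>, and
  \<open>m\<close> steps compound it.\<close>

lemma greedy_gap:
  "m \<le> H \<Longrightarrow> s < S \<Longrightarrow>
    sgn \<beta> * (exp (\<beta> * vval hist m s) - exp_value (greedy hist) (Suc H - m) m s)
     \<le> G * exp (m * max \<beta> 0) * bonus_sum hist (greedy hist) (Suc H - m) m s"
proof (induction m arbitrary: s)
  case 0
  then show ?case by (simp add: exp_value_def bonus_sum_def)
next
  case (Suc m)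
  define h where "h = H - m"
  define a where "a = greedy hist h s"
  have a: "a < A" by (simp add: a_def greedy_less)
  have h: "Suc H - Suc m = h" "Suc H - m = Suc h" "1 \<le> h" "h + m \<le> H" "h \<le> H"
    using Suc.prems by (auto simp: h_def)
  have P: "finite (set_pmf (P h s a))" "\<And>s'. s' \<in> set_pmf (P h s a) \<Longrightarrow> s' < S"
    using P_finite[OF h(3,5) _ a] P_less[OF h(3,5) _ a] Suc.prems by auto
  let ?E = "measure_pmf.expectation (P h s a)"
  let ?B = "bonus_sum hist (greedy hist) (Suc h) m" and ?W = "exp_value (greedy hist) (Suc h) m"
  have B: "0 \<le> ?E ?B" by (intro Bochner_Integration.integral_nonneg bonus_sum_nonneg)
  have "exp (\<beta> * r h s a) \<le> exp (max \<beta> 0)"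
  proof -
    have "0 \<le> r h s a" "r h s a \<le> 1" using r_bounds[OF h(3,5) _ a] Suc.prems by auto
    then have "\<beta> * r h s a \<le> max \<beta> 0"
      by (cases "\<beta> \<ge> 0") (auto simp: mult_left_le mult_nonpos_nonneg max_def)
    then show ?thesis by simp
  qed
  have V: "vval hist (Suc m) s = qval hist h s a"
    using vval_Suc(1)[of m hist s] Suc.prems by (simp add: h_def a_def)
  have W: "exp_value (greedy hist) h (Suc m) s = exp (\<beta> * r h s a) * ?E ?W"
    using exp_value_Suc[of "greedy hist", OF greedy_less h(3,4)] Suc.prems by (simp add: a_def)
  have E: "?E (\<lambda>s'. sgn \<beta> * (exp (\<beta> * vval hist m s') - ?W s'))
      = sgn \<beta> * (?E (\<lambda>s'. exp (\<beta> * vval hist m s')) - ?E ?W)"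
    using P(1) by (simp add: integrable_measure_pmf_finite)
  \<comment> \<open>Adding and subtracting the exact backup of the estimate separates the new error
    from the propagated one.\<close>
  have "sgn \<beta> * (exp (\<beta> * vval hist (Suc m) s) - exp_value (greedy hist) h (Suc m) s)
     = sgn \<beta> * (exp (\<beta> * qval hist h s a) - exp (\<beta> * r h s a) * ?E (\<lambda>s'. exp (\<beta> * vval hist m s')))
       + exp (\<beta> * r h s a) * ?E (\<lambda>s'. sgn \<beta> * (exp (\<beta> * vval hist m s') - ?W s'))"
    unfolding V W E by (simp add: algebra_simps)
  also have "\<dots> \<le> G * psi hist h s a + exp (max \<beta> 0) * (G * exp (m * max \<beta> 0) * ?E ?B)"
  proof (rule add_mono)
    show "sgn \<beta> * (exp (\<beta> * qval hist h s a) - exp (\<beta> * r h s a) * ?E (\<lambda>s'. exp (\<beta> * vval hist m s')))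
      \<le> G * psi hist h s a"
      using qval_bounds(2)[of m s a] Suc.prems a by (simp flip: h_def)
    have "?E (\<lambda>s'. sgn \<beta> * (exp (\<beta> * vval hist m s') - ?W s'))
        \<le> ?E (\<lambda>s'. G * exp (m * max \<beta> 0) * ?B s')"
      using Suc.IH P Suc.prems unfolding h by (intro expectation_pmf_mono) auto
    then have "?E (\<lambda>s'. sgn \<beta> * (exp (\<beta> * vval hist m s') - ?W s')) \<le> G * exp (m * max \<beta> 0) * ?E ?B"
      by simp
    then have "exp (\<beta> * r h s a) * ?E (\<lambda>s'. sgn \<beta> * (exp (\<beta> * vval hist m s') - ?W s'))
        \<le> exp (\<beta> * r h s a) * (G * exp (m * max \<beta> 0) * ?E ?B)"
      by (intro mult_left_mono) auto
    also have "\<dots> \<le> exp (max \<beta> 0) * (G * exp (m * max \<beta> 0) * ?E ?B)"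
      using \<open>exp (\<beta> * r h s a) \<le> exp (max \<beta> 0)\<close> B G_nonneg by (intro mult_right_mono) auto
    finally show "exp (\<beta> * r h s a) * ?E (\<lambda>s'. sgn \<beta> * (exp (\<beta> * vval hist m s') - ?W s'))
        \<le> exp (max \<beta> 0) * (G * exp (m * max \<beta> 0) * ?E ?B)" .
  qed
  also have "\<dots> = G * psi hist h s a + G * exp (Suc m * max \<beta> 0) * ?E ?B"
  proof -
    have "exp (Suc m * max \<beta> 0) = exp (max \<beta> 0) * exp (m * max \<beta> 0)"
      by (simp add: distrib_right flip: exp_add)
    then show ?thesis by (simp only: mult_ac)
  qed
  \<comment> \<open>The new bonus is enlarged by a factor of at least 1, so that both terms combine
    through \<open>bonus_sum_Suc\<close>.\<close>
  also have "\<dots> \<le> G * exp (Suc m * max \<beta> 0) * psi hist h s a + G * exp (Suc m * max \<beta> 0) * ?E ?B"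
  proof -
    have "G * 1 * psi hist h s a \<le> G * exp (Suc m * max \<beta> 0) * psi hist h s a"
      using G_nonneg psi_bounds by (intro mult_right_mono mult_left_mono) auto
    then show ?thesis by simp
  qed
  also have "\<dots> = G * exp (Suc m * max \<beta> 0) * bonus_sum hist (greedy hist) h (Suc m) s"
    using bonus_sum_Suc[of "greedy hist", OF greedy_less h(3,4)] Suc.prems by (simp add: distrib_left flip: a_def)
  finally show ?case unfolding h .
qed

section \<open>Return from the exponential scale and regret of one episode\<close>

lemma value1_le_vval:
  assumes pol: "\<And>h s. \<pi> h s < A" and "s < S"
  shows "value1 H \<beta> P r \<pi> s \<le> vval hist H s"
proof -
  have opt: "sgn \<beta> * exp_value \<pi> 1 H s \<le> sgn \<beta> * exp (\<beta> * vval hist H s)"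
    using optimism[OF pol, of H s] assms by simp
  have fin: "finite (set_pmf (rollout P \<pi> 1 H s))"
    using assms by (intro finite_rollout) auto
  \<comment> \<open>Monotonicity of \<open>ln\<close> needs positive arguments; the least
    exponential over the finite support is a positive lower bound.\<close>
  have pos: "0 < exp_value \<pi> 1 H s"
  proof -
    define c where "c = Min ((\<lambda>tr. exp (\<beta> * traj_return r 1 tr)) ` set_pmf (rollout P \<pi> 1 H s))"
    have "0 < c" unfolding c_def using fin set_pmf_not_empty by (subst Min_gr_iff) auto
    also have "c \<le> exp_value \<pi> 1 H s" unfolding exp_value_def c_def
      using fin by (intro expectation_pmf_ge Min_le) auto
    finally show ?thesis .
  qed
  have v: "value1 H \<beta> P r \<pi> s = ln (exp_value \<pi> 1 H s) / \<beta>"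
    by (simp add: value1_def exp_value_def)
  show ?thesis
  proof (cases "\<beta> > 0")
    case True
    then have "ln (exp_value \<pi> 1 H s) \<le> \<beta> * vval hist H s"
      using opt ln_mono[OF _ pos, of "exp (\<beta> * vval hist H s)"] by simp
    then show ?thesis using True by (simp add: v divide_le_eq mult.commute)
  next
    case False
    then have \<beta>: "\<beta> < 0" using beta_nz by simp
    then have "\<beta> * vval hist H s \<le> ln (exp_value \<pi> 1 H s)"
      using opt ln_mono[of "exp (\<beta> * vval hist H s)"] by simp
    then show ?thesis using \<beta> by (simp add: v divide_le_eq mult.commute)
  qed
qed

lemma value1_star_le_vval: "s < S \<Longrightarrow> value1_star H A \<beta> P r s \<le> vval hist H s"
  unfolding value1_star_def using A_pos
  \<comment> \<open>The supremum needs a nonempty set of policies; the constant policy 0 is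
    admissible as \<open>A \<ge> 1\<close>.\<close>
  by (intro cSUP_least value1_le_vval) (auto intro!: exI[of _ "\<lambda>_ _. 0"])

text \<open>The logarithm is linearized by \<open>ln x - ln y \<le> (x - y) / y\<close>. The
  denominator is at least 1 for positive \<open>\<beta>\<close> and at least
  \<open>exp (\<beta> * H)\<close> for negative \<open>\<beta>\<close>.\<close>

lemma episode_regret:
  assumes "s < S"
  shows "value1_star H A \<beta> P r s - value1 H \<beta> P r (greedy hist) s
    \<le> exp (\<bar>\<beta>\<bar> * H) * (exp (\<bar>\<beta>\<bar> * H) - 1) / \<bar>\<beta>\<bar> * bonus_sum hist (greedy hist) 1 H s"
proof -
  let ?x = "exp (\<beta> * vval hist H s)" and ?y = "exp_value (greedy hist) 1 H s"
  let ?R = "bonus_sum hist (greedy hist) 1 H s"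
  have gap: "sgn \<beta> * (?x - ?y) \<le> G * exp (H * max \<beta> 0) * ?R"
    using greedy_gap[of H s] assms by simp
  have opt: "sgn \<beta> * ?y \<le> sgn \<beta> * ?x"
    using optimism[OF greedy_less, of H s] assms by simp
  have R: "0 \<le> ?R" by (rule bonus_sum_nonneg)
  have v: "value1 H \<beta> P r (greedy hist) s = ln ?y / \<beta>"
    by (simp add: value1_def exp_value_def)
  have "vval hist H s - ln ?y / \<beta> \<le> exp (\<bar>\<beta>\<bar> * H) * (exp (\<bar>\<beta>\<bar> * H) - 1) / \<bar>\<beta>\<bar> * ?R"
  proof (cases "\<beta> > 0")
    case True
    have "1 \<le> ?y" unfolding exp_value_def
    proof (intro expectation_pmf_ge)
      show "finite (set_pmf (rollout P (greedy hist) 1 H s))"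
        using assms greedy_less by (intro finite_rollout) auto
      fix tr assume tr: "tr \<in> set_pmf (rollout P (greedy hist) 1 H s)"
      have sup: "set tr \<subseteq> triples" "length tr = H"
        using rollout_support[OF greedy_less _ _ assms tr] by auto
      have "0 \<le> r (1 + i) (fst (tr ! i)) (fst (snd (tr ! i)))" if "i < H" for i
      proof -
        have "tr ! i \<in> triples" using sup that nth_mem[of i tr] by auto
        then show ?thesis using r_bounds[of "1 + i"] that by (auto simp: triples_def)
      qed
      then have "0 \<le> traj_return r 1 tr" by (auto simp: traj_return_def sup intro!: sum_nonneg)
      then show "1 \<le> exp (\<beta> * traj_return r 1 tr)" using True by simp
    qed
    then have "ln ?x - ln ?y \<le> (?x - ?y) / ?y" by (intro ln_diff_le) auto
    also have "\<dots> \<le> (?x - ?y) / 1" using \<open>1 \<le> ?y\<close> opt True by (intro divide_left_mono) auto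
    also have "\<dots> \<le> G * exp (H * \<beta>) * ?R" using gap True by simp
    finally have "\<beta> * vval hist H s - ln ?y \<le> G * exp (H * \<beta>) * ?R" by simp
    then have "(\<beta> * vval hist H s - ln ?y) / \<beta> \<le> G * exp (H * \<beta>) * ?R / \<beta>"
      using True by (intro divide_right_mono) auto
    moreover have "G = exp (\<bar>\<beta>\<bar> * H) - 1" using True by (simp add: G_def)
    ultimately show ?thesis using True by (simp add: diff_divide_distrib mult_ac)
  next
    case False
    then have \<beta>: "\<beta> < 0" using beta_nz by simp
    have xH: "exp (\<beta> * H) \<le> ?x" using vval_bounds[of H s] assms \<beta> by simp
    have "?x \<le> ?y" using opt \<beta> by simp
    then have pos: "0 < ?y" by (rule order.strict_trans2[OF exp_gt_zero])
    then have "ln ?y - ln ?x \<le> (?y - ?x) / ?x" by (intro ln_diff_le) auto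
    also have "\<dots> \<le> (?y - ?x) / exp (\<beta> * H)" using xH opt \<beta> by (intro divide_left_mono) auto
    also have "\<dots> \<le> G * ?R / exp (\<beta> * H)" using gap \<beta> by (intro divide_right_mono) auto
    also have "\<dots> = (exp (\<bar>\<beta>\<bar> * H) - 1) * ?R"
    proof -
      have "G = 1 - exp (\<beta> * H)" using \<beta> by (simp add: G_def mult_nonpos_nonneg)
      moreover have "exp (\<bar>\<beta>\<bar> * H) = 1 / exp (\<beta> * H)" using \<beta> by (simp add: exp_minus inverse_eq_divide)
      ultimately show ?thesis by (simp add: diff_divide_distrib left_diff_distrib)
    qed
    \<comment> \<open>The extra factor of at least 1 brings the bound to the form shared with
      positive \<open>\<beta>\<close>.\<close>
    also have "\<dots> \<le> exp (\<bar>\<beta>\<bar> * H) * ((exp (\<bar>\<beta>\<bar> * H) - 1) * ?R)"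
      using R mult_right_mono[of 1 "exp (\<bar>\<beta>\<bar> * H)" "(exp (\<bar>\<beta>\<bar> * H) - 1) * ?R"] by simp
    finally have "ln ?y - \<beta> * vval hist H s \<le> exp (\<bar>\<beta>\<bar> * H) * ((exp (\<bar>\<beta>\<bar> * H) - 1) * ?R)" by simp
    then have "(ln ?y - \<beta> * vval hist H s) / \<bar>\<beta>\<bar> \<le> exp (\<bar>\<beta>\<bar> * H) * ((exp (\<bar>\<beta>\<bar> * H) - 1) * ?R) / \<bar>\<beta>\<bar>"
      by (intro divide_right_mono) auto
    then show ?thesis using \<beta> by (simp add: diff_divide_distrib mult_ac)
  qed
  then show ?thesis using value1_star_le_vval[OF assms] unfolding v by linarith
qed

end

section \<open>Summing the bonuses\<close>

definition "expected_bonus hist = bonus_sum hist (greedy hist) 1 H (init hist)"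
definition "realized_bonus hist = (\<Sum>k<length hist. traj_return (psi (take k hist)) 1 (hist ! k))"
definition "bonus_gap hist = (\<Sum>k<length hist. expected_bonus (take k hist)) - realized_bonus hist"

lemma bonus_gap_snoc:
  "bonus_gap (hist @ [ep])
     = bonus_gap hist + (expected_bonus hist - traj_return (psi hist) 1 ep)"
  by (simp add: bonus_gap_def realized_bonus_def nth_append)

text \<open>Given the past, \<open>expected_bonus\<close> is the mean of the realized sum of the
  next episode, so the gap is a martingale. The sum lies between 0 and \<open>H\<close> as
  \<open>psi \<le> 1\<close>, and Hoeffding's lemma applies to whole episodes.\<close>

lemma expectation_exp_bonus_gap:
  assumes "\<eta> > 0"
  shows "measure_pmf.expectation (run k)
    (\<lambda>hist. exp (\<eta> * bonus_gap hist - \<eta>\<^sup>2 * (real H)\<^sup>2 / 8 * length hist)) \<le> 1"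
proof (rule run_supermartingale)
  let ?c = "\<eta>\<^sup>2 * (real H)\<^sup>2 / 8"
  let ?F = "\<lambda>hist. exp (\<eta> * bonus_gap hist - ?c * length hist)"
  show "?F [] \<le> 1" by (simp add: bonus_gap_def realized_bonus_def)
  fix hist
  let ?f = "\<lambda>ep. - traj_return (psi hist) 1 ep"
  have E: "expected_bonus hist = - measure_pmf.expectation (next_episode hist) ?f"
    by (simp add: expected_bonus_def bonus_sum_def next_episode_def)
  have "?F (hist @ [ep]) = ?F hist * exp (- ?c)
      * exp (\<eta> * (?f ep - measure_pmf.expectation (next_episode hist) ?f))" for ep
    unfolding bonus_gap_snoc E by (simp only: mult_exp_exp) (simp add: algebra_simps)
  then have "measure_pmf.expectation (next_episode hist) (\<lambda>ep. ?F (hist @ [ep]))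
    = ?F hist * exp (- ?c) * measure_pmf.expectation (next_episode hist)
        (\<lambda>ep. exp (\<eta> * (?f ep - measure_pmf.expectation (next_episode hist) ?f)))"
    by simp
  also have "\<dots> \<le> ?F hist * exp (- ?c) * exp (\<eta>\<^sup>2 * (0 - (- real H))\<^sup>2 / 8)"
  proof (intro mult_left_mono Hoeffdings_lemma_pmf finite_next_episode assms)
    fix ep assume "ep \<in> set_pmf (next_episode hist)"
    then have "length ep = H" using next_episode_support by (auto simp: episodes_def)
    then show "?f ep \<in> {- real H..0}" using traj_return_psi_bounds[of hist 1 ep] by simp
  qed simp
  also have "\<dots> = ?F hist" by (simp flip: exp_add)
  finally show "measure_pmf.expectation (next_episode hist) (\<lambda>ep. ?F (hist @ [ep])) \<le> ?F hist" .
qed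

lemma prob_bonus_gap:
  "measure_pmf.prob (run K) {hist. H * sqrt (K * L) < bonus_gap hist} \<le> \<delta> / 2"
proof -
  \<comment> \<open>Again the optimal Chernoff parameter: the exponent is
    \<open>4 * L - 2 * L\<close>.\<close>
  define \<eta> where "\<eta> = 4 * sqrt (L / K) / H"
  have \<eta>: "\<eta> > 0" using L_ge H_pos K_pos by (simp add: \<eta>_def)
  have "sqrt (L / K) * sqrt (K * L) = sqrt (L\<^sup>2)"
    using K_pos by (subst real_sqrt_mult[symmetric]) (simp add: power2_eq_square)
  then have 1: "\<eta> * (H * sqrt (K * L)) = 4 * L" using H_pos L_ge by (simp add: \<eta>_def)
  have 2: "\<eta>\<^sup>2 * (real H)\<^sup>2 / 8 * K = 2 * L"
    using H_pos K_pos L_ge by (simp add: \<eta>_def power_divide power_mult_distrib)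
  have "measure_pmf.prob (run K) {hist. H * sqrt (K * L) < bonus_gap hist} \<le> 1 / exp (2 * L)"
  proof (rule pmf_exponential_Markov[OF finite_run _ expectation_exp_bonus_gap[OF \<eta>]])
    fix hist assume *: "hist \<in> set_pmf (run K)" "hist \<in> {hist. H * sqrt (K * L) < bonus_gap hist}"
    then have "\<eta> * (H * sqrt (K * L)) \<le> \<eta> * bonus_gap hist" using \<eta> by simp
    then show "exp (2 * L) \<le> exp (\<eta> * bonus_gap hist - \<eta>\<^sup>2 * (real H)\<^sup>2 / 8 * length hist)"
      using run_support[OF *(1)] 1 2 by simp
  qed auto
  also have "\<dots> = exp (- L) * exp (- L)" by (simp add: exp_minus inverse_eq_divide flip: exp_add)
  also have "\<dots> \<le> exp (- L) * 1" using L_ge by (intro mult_left_mono) auto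
  finally show ?thesis using exp_minus_L_le by simp
qed

lemma count_N_snoc:
  "count_N (hist @ [ep]) h s a = count_N hist h s a
     + (if (s, a) = (fst (ep ! (h - 1)), fst (snd (ep ! (h - 1)))) then 1 else 0)"
  by (auto simp: count_N_def matches_snoc split: prod.split)

text \<open>A visit costs at most the growth it causes in the potential
  \<open>12 * sqrt (S * L) * sqrt N\<close>, with \<open>12 = 4 * 3\<close> from \<open>psi\<close>
  and \<open>inverse_sqrt_le_diff\<close>.\<close>

lemma psi_le_diff:
  "psi hist h s a \<le> 12 * sqrt (S * L)
     * (sqrt (count_N hist h s a + 1) - sqrt (count_N hist h s a))"
proof (cases "count_N hist h s a = 0")
  case True
  \<comment> \<open>At the first visit \<open>psi\<close> is 1 and the root grows from 0 to 1, so
    \<open>12 * sqrt (S * L) \<ge> 1\<close> is needed.\<close>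
  have "sqrt ((1 / 2)\<^sup>2) \<le> sqrt (S * L)"
  proof (rule real_sqrt_le_mono)
    have "1 * (1 / 2) \<le> S * L" using L_ge S_pos by (intro mult_mono) auto
    then show "(1 / 2)\<^sup>2 \<le> S * L" by (simp add: power2_eq_square)
  qed
  then have "1 / 2 \<le> sqrt (S * L)" by simp
  then show ?thesis using True by (simp add: psi_def)
next
  case False
  then have "psi hist h s a \<le> 4 * sqrt (S * L) * (1 / sqrt (count_N hist h s a))"
    by (simp add: psi_def)
  also have "\<dots> \<le> 4 * sqrt (S * L) * (3 * (sqrt (count_N hist h s a + 1) - sqrt (count_N hist h s a)))"
    using False L_ge inverse_sqrt_le_diff[of "count_N hist h s a"] by (intro mult_left_mono) auto
  finally show ?thesis by (simp add: right_diff_distrib)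
qed

text \<open>Each appended episode raises exactly one count of step \<open>h\<close> by one, and its
  bonus uses the count before the increase; so both claims follow by induction over
  episodes.\<close>

lemma step_bonus_potential:
  assumes "set hist \<subseteq> episodes" "1 \<le> h" "h \<le> H"
  shows "(\<Sum>k<length hist. psi (take k hist) h (fst (hist ! k ! (h - 1))) (fst (snd (hist ! k ! (h - 1)))))
      \<le> 12 * sqrt (S * L) * (\<Sum>(s, a)\<in>{..<S} \<times> {..<A}. sqrt (count_N hist h s a))"
    and "(\<Sum>(s, a)\<in>{..<S} \<times> {..<A}. real (count_N hist h s a)) = length hist"
proof -
  have "(\<Sum>k<length hist. psi (take k hist) h (fst (hist ! k ! (h - 1))) (fst (snd (hist ! k ! (h - 1)))))
      \<le> 12 * sqrt (S * L) * (\<Sum>(s, a)\<in>{..<S} \<times> {..<A}. sqrt (count_N hist h s a)) \<and>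
    (\<Sum>(s, a)\<in>{..<S} \<times> {..<A}. real (count_N hist h s a)) = length hist"
    using assms(1)
  proof (induction hist rule: rev_induct)
    case Nil
    then show ?case by (simp add: count_N_def matches_def data_h_def)
  next
    case (snoc ep hist)
    define s where "s = fst (ep ! (h - 1))"
    define a where "a = fst (snd (ep ! (h - 1)))"
    have "set ep \<subseteq> triples" "h - 1 < length ep" using snoc.prems assms by (auto simp: episodes_def)
    then have "ep ! (h - 1) \<in> triples" using nth_mem[of "h - 1" ep] by blast
    then have sa: "(s, a) \<in> {..<S} \<times> {..<A}" by (auto simp: triples_def s_def a_def)
    have c: "count_N (hist @ [ep]) h s a = count_N hist h s a + 1"
      by (simp add: count_N_snoc s_def a_def)
    have c': "count_N (hist @ [ep]) h s' a' = count_N hist h s' a'" if "(s', a') \<noteq> (s, a)" for s' a'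
      using that by (auto simp: count_N_snoc s_def a_def)
    \<comment> \<open>Stated for a general \<open>f\<close>, to be used with \<open>sqrt\<close> for
      the bonuses and with \<open>real\<close> for the total count.\<close>
    have sum: "(\<Sum>(s, a)\<in>{..<S} \<times> {..<A}. f (count_N (hist @ [ep]) h s a))
      = (\<Sum>(s, a)\<in>{..<S} \<times> {..<A}. f (count_N hist h s a))
        + (f (count_N hist h s a + 1) - f (count_N hist h s a))" for f :: "nat \<Rightarrow> real"
      using sum_update_one[of "{..<S} \<times> {..<A}" "(s, a)"
          "\<lambda>(s, a). f (count_N (hist @ [ep]) h s a)" "\<lambda>(s, a). f (count_N hist h s a)"] sa c c'
      by auto
    have "(\<Sum>k<length (hist @ [ep]). psi (take k (hist @ [ep])) h
          (fst ((hist @ [ep]) ! k ! (h - 1))) (fst (snd ((hist @ [ep]) ! k ! (h - 1)))))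
      = (\<Sum>k<length hist. psi (take k hist) h (fst (hist ! k ! (h - 1))) (fst (snd (hist ! k ! (h - 1)))))
        + psi hist h s a"
      by (simp add: nth_append s_def a_def)
    also have "\<dots> \<le> 12 * sqrt (S * L) * (\<Sum>(s, a)\<in>{..<S} \<times> {..<A}. sqrt (count_N hist h s a))
        + 12 * sqrt (S * L) * (sqrt (count_N hist h s a + 1) - sqrt (count_N hist h s a))"
      using snoc psi_le_diff[of hist h s a] by (intro add_mono) auto
    also have "\<dots> = 12 * sqrt (S * L) * (\<Sum>(s, a)\<in>{..<S} \<times> {..<A}. sqrt (count_N (hist @ [ep]) h s a))"
      unfolding sum[of sqrt] by (simp add: distrib_left)
    finally show ?case using snoc sum[of real] by simp
  qed
  then show "(\<Sum>k<length hist. psi (take k hist) h (fst (hist ! k ! (h - 1))) (fst (snd (hist ! k ! (h - 1)))))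
      \<le> 12 * sqrt (S * L) * (\<Sum>(s, a)\<in>{..<S} \<times> {..<A}. sqrt (count_N hist h s a))"
    and "(\<Sum>(s, a)\<in>{..<S} \<times> {..<A}. real (count_N hist h s a)) = length hist" by auto
qed

lemma realized_bonus_le:
  assumes "set hist \<subseteq> episodes"
  shows "realized_bonus hist \<le> 12 * real H * sqrt (S * L) * sqrt (S * A * length hist)"
proof -
  have len: "length (hist ! k) = H" if "k < length hist" for k
    using that assms nth_mem[of k hist] by (force simp: episodes_def)
  have "realized_bonus hist
    = (\<Sum>i<H. \<Sum>k<length hist. psi (take k hist) (1 + i) (fst (hist ! k ! i)) (fst (snd (hist ! k ! i))))"
    unfolding realized_bonus_def traj_return_def by (subst sum.swap) (simp add: len)
  also have "\<dots> \<le> (\<Sum>i<H. 12 * sqrt (S * L) * sqrt (S * A * length hist))"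
  proof (rule sum_mono)
    fix i assume "i \<in> {..<H}"
    then have h: "1 \<le> 1 + i" "1 + i \<le> H" by auto
    let ?X = "{..<S} \<times> {..<A}"
    let ?f = "\<lambda>(s, a). sqrt (count_N hist (1 + i) s a)"
    \<comment> \<open>Cauchy-Schwarz over the \<open>S * A\<close> pairs, whose counts total the
      number of episodes.\<close>
    have "(\<Sum>x\<in>?X. ?f x)\<^sup>2 \<le> (\<Sum>x\<in>?X. (?f x)\<^sup>2) * card ?X"
      by (rule sum_squared_le_sum_of_squares)
    also have "(\<Sum>x\<in>?X. (?f x)\<^sup>2) = length hist"
      using step_bonus_potential(2)[OF assms h] by (simp add: split_beta)
    finally have "(\<Sum>x\<in>?X. ?f x) \<le> sqrt (S * A * length hist)"
      by (intro real_le_rsqrt) (simp add: mult_ac)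
    then have "12 * sqrt (S * L) * (\<Sum>x\<in>?X. ?f x) \<le> 12 * sqrt (S * L) * sqrt (S * A * length hist)"
      using L_ge by (intro mult_left_mono) auto
    then show "(\<Sum>k<length hist. psi (take k hist) (1 + i) (fst (hist ! k ! i)) (fst (snd (hist ! k ! i))))
       \<le> 12 * sqrt (S * L) * sqrt (S * A * length hist)"
      using step_bonus_potential(1)[OF assms h] by simp
  qed
  finally show ?thesis by simp
qed

section \<open>Assembly of the regret bound\<close>

lemma regret_of_good_history:
  assumes hist: "set hist \<subseteq> episodes" "length hist = K"
    and good: "\<And>k. k < K \<Longrightarrow> good (take k hist)" and gap: "bonus_gap hist \<le> H * sqrt (K * L)"
  shows "rsvi_regret H S A \<beta> 2 \<delta> (K * H) r sel P init K hist
    \<le> 26 * lam (\<bar>\<beta>\<bar> * real H ^ 2)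
        * sqrt (real H ^ 3 * real S ^ 2 * real A * real (K * H) * L ^ 2)"
proof -
  define y where "y = exp (\<bar>\<beta>\<bar> * H)"
  define M where "M = y * (y - 1) / \<bar>\<beta>\<bar>"
  define Z where "Z = S * sqrt (A * K)"
  have y: "1 \<le> y" by (simp add: y_def)
  have M: "0 \<le> M" using y by (simp add: M_def)
  have L: "0 \<le> L" using L_ge by simp
  have "rsvi_regret H S A \<beta> 2 \<delta> (K * H) r sel P init K hist
      \<le> (\<Sum>k<K. M * expected_bonus (take k hist))"
    unfolding rsvi_regret_def
  proof (rule sum_mono)
    fix k assume "k \<in> {..<K}"
    moreover have "set (take k hist) \<subseteq> episodes" using hist(1) set_take_subset by fast
    ultimately show "value1_star H A \<beta> P r (init (take k hist))
        - value1 H \<beta> P r (greedy (take k hist)) (init (take k hist)) \<le> M * expected_bonus (take k hist)"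
      unfolding M_def y_def expected_bonus_def by (intro episode_regret good init_less) auto
  qed
  also have "\<dots> = M * (bonus_gap hist + realized_bonus hist)"
    by (simp add: bonus_gap_def hist sum_distrib_left)
  also have "\<dots> \<le> M * (26 * (H * Z * L))"
  proof (rule mult_left_mono[OF _ M])
    have Z: "sqrt (S * L) * sqrt (S * A * K) = Z * sqrt L"
      by (simp add: Z_def real_sqrt_mult)
    have "realized_bonus hist \<le> 12 * real H * sqrt (S * L) * sqrt (S * A * K)"
      using realized_bonus_le[OF hist(1)] hist(2) by simp
    also have "\<dots> = 12 * (H * (Z * sqrt L))"
      using Z by (simp only: mult.assoc)
    finally have "realized_bonus hist \<le> 12 * (H * (Z * sqrt L))" .
    moreover have "sqrt (K * L) \<le> Z * sqrt L"
    proof -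
      have "K \<le> A * K" using A_pos by simp
      then have "1 * sqrt K \<le> Z"
        unfolding Z_def using S_pos by (intro mult_mono real_sqrt_le_mono) (auto simp flip: of_nat_mult)
      then show ?thesis using L by (auto simp: real_sqrt_mult intro: mult_right_mono)
    qed
    then have "H * sqrt (K * L) \<le> H * (Z * sqrt L)" by (intro mult_left_mono) auto
    \<comment> \<open>The constant 13 is 12 from the realized bonuses and 1 from the gap;
      \<open>sqrt L \<le> 2 * L\<close> then doubles it to 26.\<close>
    ultimately have "bonus_gap hist + realized_bonus hist \<le> 13 * (H * (Z * sqrt L))"
      using gap by simp
    also have "\<dots> \<le> 13 * (H * (Z * (2 * L)))"
    proof (intro mult_left_mono)
      have "L * 1 \<le> L * (4 * L)" using L_ge by (intro mult_left_mono) auto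
      then show "sqrt L \<le> 2 * L" using L by (intro real_le_lsqrt) (auto simp: power2_eq_square)
    qed (auto simp: Z_def)
    finally show "bonus_gap hist + realized_bonus hist \<le> 26 * (H * Z * L)" by (simp add: mult_ac)
  qed
  also have "\<dots> = 26 * (H * (y * (y - 1)) / \<bar>\<beta>\<bar> * (Z * L))"
    by (simp add: M_def)
  \<comment> \<open>The factor \<open>H\<close> is absorbed into the exponent, which becomes the
    \<open>3 * \<bar>\<beta>\<bar> * H ^ 2\<close> of \<open>lam\<close>.\<close>
  also have "\<dots> \<le> 26 * ((y ^ (3 * H) - 1) / \<bar>\<beta>\<bar> * (Z * L))"
    using exp_factor_le[OF y H_pos] L
    by (intro mult_left_mono mult_right_mono divide_right_mono) (auto simp: Z_def)
  also have "\<dots> = 26 * lam (\<bar>\<beta>\<bar> * real H ^ 2)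
        * sqrt (real H ^ 3 * real S ^ 2 * real A * real (K * H) * L ^ 2)"
  proof -
    \<comment> \<open>The factor \<open>H ^ 2\<close> of the root cancels against the denominator
      \<open>\<bar>\<beta>\<bar> * H ^ 2\<close> of \<open>lam\<close>.\<close>
    have "real H ^ 3 * real S ^ 2 * real A * real (K * H) * L ^ 2
        = (real H ^ 2 * Z * L)\<^sup>2"
      by (simp add: Z_def power_mult_distrib power2_eq_square power3_eq_cube)
    then have "sqrt (real H ^ 3 * real S ^ 2 * real A * real (K * H) * L ^ 2) = real H ^ 2 * Z * L"
      using L by (simp add: Z_def)
    moreover have "y ^ (3 * H) = exp (3 * (\<bar>\<beta>\<bar> * real H ^ 2))"
      by (simp add: y_def power2_eq_square mult_ac flip: exp_of_nat_mult)
    ultimately show ?thesis using H_pos by (simp add: lam_def)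
  qed
  finally show ?thesis .
qed

text \<open>Two failure events of probability at most \<open>\<delta> / 2\<close> each; outside
  both, the bound holds for every history in the support.\<close>

lemma prob_regret:
  "1 - \<delta> \<le> measure_pmf.prob (run K)
    {hist. rsvi_regret H S A \<beta> 2 \<delta> (K * H) r sel P init K hist
      \<le> 26 * lam (\<bar>\<beta>\<bar> * real H ^ 2)
        * sqrt (real H ^ 3 * real S ^ 2 * real A * real (K * H) * L ^ 2)}" (is "_ \<le> measure_pmf.prob _ ?E")
proof -
  let ?B1 = "{hist. \<exists>k<K. \<not> good (take k hist)}"
  let ?B2 = "{hist. H * sqrt (K * L) < bonus_gap hist}"
  have "hist \<in> ?E" if "hist \<in> set_pmf (run K)" "hist \<notin> ?B1 \<union> ?B2" for hist
    using regret_of_good_history[of hist] run_support[OF that(1)] that(2) by auto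
  then have "measure_pmf.prob (run K) (- ?E) \<le> measure_pmf.prob (run K) (?B1 \<union> ?B2)"
    by (intro measure_pmf.finite_measure_mono_AE) (auto simp: AE_measure_pmf_iff)
  also have "\<dots> \<le> measure_pmf.prob (run K) ?B1 + measure_pmf.prob (run K) ?B2"
    by (intro measure_Un_le) auto
  also have "\<dots> \<le> \<delta>" using prob_not_good prob_bonus_gap by linarith
  finally show ?thesis
    using measure_pmf.prob_compl[of ?E "run K"] by (simp add: Compl_eq_Diff_UNIV)
qed

end

theorem theorem1:
  shows "\<exists>c\<gamma>::real. c\<gamma> > 0 \<and> (\<exists>C::real. C > 0 \<and>
    (\<forall>(S::nat) (A::nat) (H::nat) (K::nat) (\<beta>::real) (\<delta>::real)
       (P :: nat \<Rightarrow> nat \<Rightarrow> nat \<Rightarrow> nat pmf) (r :: nat \<Rightarrow> nat \<Rightarrow> nat \<Rightarrow> real)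
       (init :: history \<Rightarrow> nat) (sel :: (nat \<Rightarrow> real) \<Rightarrow> nat).
       S \<ge> 1 \<longrightarrow> A \<ge> 1 \<longrightarrow> H \<ge> 1 \<longrightarrow> \<beta> \<noteq> 0 \<longrightarrow> 0 < \<delta> \<longrightarrow> \<delta> \<le> 1 \<longrightarrow>
       (\<forall>h s a. 1 \<le> h \<longrightarrow> h \<le> H \<longrightarrow> s < S \<longrightarrow> a < A \<longrightarrow> set_pmf (P h s a) \<subseteq> {..<S}) \<longrightarrow>
       (\<forall>h s a. 1 \<le> h \<longrightarrow> h \<le> H \<longrightarrow> s < S \<longrightarrow> a < A \<longrightarrow> 0 \<le> r h s a \<and> r h s a \<le> 1) \<longrightarrow>
       (\<forall>hist. init hist < S) \<longrightarrow>
       (\<forall>f. sel f < A \<and> (\<forall>a<A. f a \<le> f (sel f))) \<longrightarrow>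
       (let T = K * H in
        measure_pmf.prob (rsvi_run H S A \<beta> c\<gamma> \<delta> T r sel P init K)
          {hist. rsvi_regret H S A \<beta> c\<gamma> \<delta> T r sel P init K hist
                 \<le> C * lam (\<bar>\<beta>\<bar> * real H ^ 2)
                     * sqrt (real H ^ 3 * real S ^ 2 * real A * real T
                             * (ln (2 * real S * real A * real T / \<delta>)) ^ 2)}
        \<ge> 1 - \<delta>)))"
proof (rule exI[of _ 2], rule conjI, simp, rule exI[of _ 26], rule conjI, simp, intro allI impI)
  fix S A H K :: nat and \<beta> \<delta> :: real
    and P :: "nat \<Rightarrow> nat \<Rightarrow> nat \<Rightarrow> nat pmf" and r :: "nat \<Rightarrow> nat \<Rightarrow> nat \<Rightarrow> real"
    and init :: "history \<Rightarrow> nat" and sel :: "(nat \<Rightarrow> real) \<Rightarrow> nat"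
  assume "1 \<le> S" "1 \<le> A" "1 \<le> H" "\<beta> \<noteq> 0" "0 < \<delta>" "\<delta> \<le> 1"
    and "\<forall>h s a. 1 \<le> h \<longrightarrow> h \<le> H \<longrightarrow> s < S \<longrightarrow> a < A \<longrightarrow> set_pmf (P h s a) \<subseteq> {..<S}"
    and "\<forall>h s a. 1 \<le> h \<longrightarrow> h \<le> H \<longrightarrow> s < S \<longrightarrow> a < A \<longrightarrow> 0 \<le> r h s a \<and> r h s a \<le> 1"
    and "\<forall>hist. init hist < S" and "\<forall>f. sel f < A \<and> (\<forall>a<A. f a \<le> f (sel f))"
  note asms = this
  show "let T = K * H in
        measure_pmf.prob (rsvi_run H S A \<beta> 2 \<delta> T r sel P init K)
          {hist. rsvi_regret H S A \<beta> 2 \<delta> T r sel P init K hist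
                 \<le> 26 * lam (\<bar>\<beta>\<bar> * real H ^ 2)
                     * sqrt (real H ^ 3 * real S ^ 2 * real A * real T
                             * (ln (2 * real S * real A * real T / \<delta>)) ^ 2)}
        \<ge> 1 - \<delta>"
  proof (cases "K = 0")
    case True
    \<comment> \<open>With no episodes the regret is an empty sum and the root vanishes as
      \<open>T = 0\<close>, so the event has probability 1.\<close>
    then show ?thesis using \<open>0 < \<delta>\<close> by (simp add: rsvi_regret_def)
  next
    case False
    interpret rsvi_setting S A H K \<beta> \<delta> P r init sel
      using asms False by unfold_locales auto
    show ?thesis using prob_regret unfolding Let_def L_def .
  qed
qed

end
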